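(* Let $\mathbb{K}$ be a field of characteristic zero and let $\alpha\in\mathbb{K}$ with $\alpha\neq 0,1$. Let $X_3=X_3(\alpha)$ be the arrangement in $\mathbb{K}^3$ consisting of the six planes $H_1=\{x=0\}$, $H_2=\{y=0\}$, $H_3=\{z=0\}$, $H_4=\{x-\alpha y=0\}$, $H_5=\{x+z=0\}$, $H_6=\{y+z=0\}$, and let $\mathbf{m}=[m_1,\dots,m_6]$ be a vector of positive integers, where $m_i$ is the multiplicity of $H_i$. If $(X_3,\mathbf{m})$ is free, then $m_4=m_5=m_6=1$ and $m_1=m_2=m_3=n$ for some positive integer $n$; that is, free multiplicities are of the form $[n,n,n,1,1,1]$. Furthermore: (1) if $\alpha$ is not a root of unity, then $[n,n,n,1,1,1]$ is a free multiplicity for every integer $n>1$; (2) if $\alpha$ is a root of unity of order $m$, then $[n,n,n,1,1,1]$ is a free multiplicity if and only if $n\not\equiv 1 \pmod m$ (in particular, if $\alpha=-1$, then $[n,n,n,1,1,1]$ is a free multiplicity if and only if $n$ is even). Moreover, whenever $(X_3,\mathbf{m})$ is free (so $\mathbf{m}=[n,n,n,1,1,1]$), its exponents are $(n+1,n+1,n+1)$.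
   Context: Let $S=\mathbb{K}[x,y,z]$ and let $\mathrm{Der}(S)$ be the free $S$-module of $\mathbb{K}$-linear derivations of $S$, with basis $\partial/\partial x,\partial/\partial y,\partial/\partial z$. For an arrangement $\mathcal{A}=\{H_i\}$ of planes $H_i=\{\alpha_i=0\}$ ($\alpha_i$ a linear form) with positive integer multiplicities $\mathbf{m}(H_i)=m_i$, set $$D(\mathcal{A},\mathbf{m})=\{\theta\in\mathrm{Der}(S) : \theta(\alpha_i)\in\alpha_i^{m_i}S\ \text{for all } i\}.$$ The multiplicity $\mathbf{m}$ is called free (equivalently, $(\mathcal{A},\mathbf{m})$ is called free) if $D(\mathcal{A},\mathbf{m})$ is a free $S$-module. In that case the exponents are the polynomial degrees of the elements of a homogeneous basis, where a derivation $\sum_j\theta_j\,\partial/\partial x_j$ is homogeneous of degree $d$ if all nonzero $\theta_j$ are homogeneous polynomials of degree $d$. The order of a root of unity $\alpha$ is the least positive integer $m$ with $\alpha^m=1$. *)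

theory Defs
  imports
    "HOL-Computational_Algebra.Computational_Algebra"
    "HOL-Number_Theory.Cong"
    "HOL-Library.Function_Algebras"
    "HOL-Library.Multiset"
begin

(* The polynomial ring S = K[x,y,z] is realised as the iterated polynomial ring K[x][y][z]:
   x is the innermost and z the outermost variable, so the coefficient of x^i y^j z^k in p is
   coeff (coeff (coeff p k) j) i. *)

type_synonym 'k poly3 = "'k poly poly poly"

definition Const :: "'k::comm_ring_1 \<Rightarrow> 'k poly3"
  where "Const c = [:[:[:c:]:]:]"

definition varX :: "'k::comm_ring_1 poly3" where "varX = [:[:[:0, 1:]:]:]"
definition varY :: "'k::comm_ring_1 poly3" where "varY = [:[:0, 1:]:]"
definition varZ :: "'k::comm_ring_1 poly3" where "varZ = [:0, 1:]"

(* The zero polynomial is homogeneous of every degree. *)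
definition homogeneous_poly :: "nat \<Rightarrow> 'k::comm_ring_1 poly3 \<Rightarrow> bool"
  where "homogeneous_poly d p \<longleftrightarrow>
    (\<forall>i j k. coeff (coeff (coeff p k) j) i \<noteq> 0 \<longrightarrow> i + j + k = d)"

definition Der :: "('k::comm_ring_1 poly3 \<Rightarrow> 'k poly3) set"
  where "Der = {\<theta>. (\<forall>p q. \<theta> (p + q) = \<theta> p + \<theta> q) \<and>
                    (\<forall>c p. \<theta> (Const c * p) = Const c * \<theta> p) \<and>
                    (\<forall>p q. \<theta> (p * q) = \<theta> p * q + p * \<theta> q)}"

(* The S-module structure on maps S -> S; addition is the pointwise one of Function_Algebras. *)
definition der_scale :: "'k::comm_ring_1 poly3 \<Rightarrow> ('k poly3 \<Rightarrow> 'k poly3) \<Rightarrow> 'k poly3 \<Rightarrow> 'k poly3"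
  where "der_scale f \<theta> = (\<lambda>p. f * \<theta> p)"

lemma module_der_scale: "module der_scale"
  by unfold_locales (simp_all add: der_scale_def fun_eq_iff algebra_simps)

definition partialX :: "'k::field poly3 \<Rightarrow> 'k poly3"
  where "partialX = map_poly (map_poly pderiv)"

definition partialY :: "'k::field poly3 \<Rightarrow> 'k poly3"
  where "partialY = map_poly pderiv"

definition partialZ :: "'k::field poly3 \<Rightarrow> 'k poly3"
  where "partialZ = pderiv"

lemma partial_var:
  "partialX varX = 1" "partialX varY = 0" "partialX varZ = 0"
  "partialY varX = 0" "partialY varY = 1" "partialY varZ = 0"
  "partialZ varX = 0" "partialZ varY = 0" "partialZ varZ = 1"
  by (simp_all add: partialX_def partialY_def partialZ_def varX_def varY_def varZ_def
      map_poly_pCons pderiv_pCons one_pCons)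

definition homogeneous_der :: "nat \<Rightarrow> ('k::field poly3 \<Rightarrow> 'k poly3) \<Rightarrow> bool"
  where "homogeneous_der d \<theta> \<longleftrightarrow>
    (\<exists>a b c. \<theta> = der_scale a partialX + der_scale b partialY + der_scale c partialZ \<and>
             homogeneous_poly d a \<and> homogeneous_poly d b \<and> homogeneous_poly d c)"

(* D(A,m), for the list A of defining linear forms and the list m of their multiplicities. *)
definition multi_der :: "'k::comm_ring_1 poly3 list \<Rightarrow> nat list \<Rightarrow> ('k poly3 \<Rightarrow> 'k poly3) set"
  where "multi_der A m = {\<theta> \<in> Der. \<forall>i < length A. (A ! i) ^ (m ! i) dvd \<theta> (A ! i)}"

definition is_basis :: "('k::comm_ring_1 poly3 \<Rightarrow> 'k poly3) set \<Rightarrow> ('k poly3 \<Rightarrow> 'k poly3) set \<Rightarrow> bool"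
  where "is_basis B M \<longleftrightarrow> \<not> module.dependent der_scale B \<and> module.span der_scale B = M"

definition free_multiplicity :: "'k::comm_ring_1 poly3 list \<Rightarrow> nat list \<Rightarrow> bool"
  where "free_multiplicity A m \<longleftrightarrow> (\<exists>B. is_basis B (multi_der A m))"

(* E is the multiset of degrees of some homogeneous basis of D(A,m). *)
definition exponents :: "'k::field poly3 list \<Rightarrow> nat list \<Rightarrow> nat multiset \<Rightarrow> bool"
  where "exponents A m E \<longleftrightarrow>
    (\<exists>B deg. finite B \<and> is_basis B (multi_der A m) \<and>
             (\<forall>\<theta>\<in>B. homogeneous_der (deg \<theta>) \<theta>) \<and> E = image_mset deg (mset_set B))"

definition X3 :: "'k::comm_ring_1 \<Rightarrow> 'k poly3 list"
  where "X3 \<alpha> = [varX, varY, varZ, varX - Const \<alpha> * varY, varX + varZ, varY + varZ]"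

definition root_of_unity :: "'k::field \<Rightarrow> bool"
  where "root_of_unity a \<longleftrightarrow> (\<exists>k>0. a ^ k = 1)"

definition root_order :: "'k::field \<Rightarrow> nat"
  where "root_order a = (LEAST k. 0 < k \<and> a ^ k = 1)"

end

theory Submission
  imports Defs
begin

text \<open>
  A derivation \<open>\<theta>\<close> is determined by its values at \<open>x, y, z\<close>. Those in the module \<open>D\<close> of the multiarrangement
  have the form \<open>(x^p g\<^sub>1, y^q g\<^sub>2, z^r g\<^sub>3)\<close>, and the planes \<open>x - \<alpha> y\<close>, \<open>x + z\<close>, \<open>y + z\<close>, of multiplicities
  \<open>a, b, c\<close>, impose one congruence on each pair of these components.

  \<^bold>\<open>Necessity.\<close> If \<open>D\<close> is free, then syzygies with values in \<open>D\<close> of a regular sequence of length three are Koszul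
  syzygies. Consequently an inhomogeneous version of the congruences is solvable whenever its multiples
  by the members \<open>l\<^sub>1, l\<^sub>2, l\<^sub>3\<close> of a regular sequence are (\<open>free_multi_der_lift\<close>). Three systems of this
  kind have evident solutions after multiplication: the one asking for \<open>x^p\<close> at \<open>x - \<alpha> y\<close>, the one asking
  for \<open>y^q\<close> at \<open>x - \<alpha> y\<close>, and the one asking for \<open>z^r\<close> at \<open>x + z\<close>. Hence they are solvable. On
  the lines spanned by \<open>(\<alpha>, 1, 0)\<close>, \<open>(- 1, 0, 1)\<close> and \<open>(0, - 1, 1)\<close> the moduli vanish, and the terms of lowest degree give linear
  equations between the constant terms of \<open>g\<^sub>1, g\<^sub>2, g\<^sub>3\<close> (\<open>X3_cong_leading_terms\<close>). These equations are
  contradictory unless \<open>p = q = r = n\<close>. In that case they determine the constant terms, contradict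
  \<open>\<alpha>^(n - 1) = 1\<close>, and, after differentiation of a congruence, contradict \<open>a > 1\<close>, \<open>b > 1\<close> and \<open>c > 1\<close>.

  \<^bold>\<open>Sufficiency.\<close> For \<open>[n,n,n,1,1,1]\<close> write the components as \<open>(x^n u, y^n v, - (- z)^n w)\<close> and put
  \<open>\<beta> = \<alpha>^(n - 1)\<close>. Membership in \<open>D\<close> then says that \<open>x - \<alpha> y\<close> divides \<open>v - \<beta> u\<close>, that \<open>x + z\<close> divides
  \<open>u - w\<close>, and that \<open>y + z\<close> divides \<open>w - v\<close> (\<open>multi_der_coordinates\<close>). If \<open>\<beta> \<noteq> 1\<close>, the three differences
  determine \<open>u, v, w\<close>, and their quotients by the linear forms can be prescribed arbitrarily. They are
  coordinates for a basis of three derivations of degree \<open>n + 1\<close> (\<open>is_basis_X3\<close>).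

  \<^bold>\<open>Exponents.\<close> By a graded argument in the style of Nakayama's lemma, any finite homogeneous basis has the degrees of this
  one (\<open>homogeneous_basis_unique\<close>). Finally, \<open>\<alpha>^(n - 1) = 1\<close> is translated into a congruence
  modulo the order of \<open>\<alpha>\<close>.
\<close>

section \<open>Substitution homomorphisms\<close>

definition is_ring_hom :: "('a::comm_ring_1 \<Rightarrow> 'b::comm_ring_1) \<Rightarrow> bool"
  where "is_ring_hom \<phi> \<longleftrightarrow>
    (\<forall>p q. \<phi> (p + q) = \<phi> p + \<phi> q) \<and> (\<forall>p q. \<phi> (p * q) = \<phi> p * \<phi> q) \<and> \<phi> 1 = 1"

lemma is_ring_homD:
  assumes "is_ring_hom \<phi>"
  shows "\<phi> (p + q) = \<phi> p + \<phi> q" "\<phi> (p * q) = \<phi> p * \<phi> q" "\<phi> 1 = 1" "\<phi> 0 = 0"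
    "\<phi> (- p) = - \<phi> p" "\<phi> (p - q) = \<phi> p - \<phi> q" "\<phi> (p ^ n) = \<phi> p ^ n"
proof -
  show add: "\<phi> (p + q) = \<phi> p + \<phi> q" for p q using assms by (simp add: is_ring_hom_def)
  show mult: "\<phi> (p * q) = \<phi> p * \<phi> q" for p q using assms by (simp add: is_ring_hom_def)
  show one: "\<phi> 1 = 1" using assms by (simp add: is_ring_hom_def)
  show zero: "\<phi> 0 = 0" using add[of 0 0] by simp
  show minus: "\<phi> (- p) = - \<phi> p" for p using add[of p "- p"] zero by (simp add: eq_neg_iff_add_eq_0 add.commute)
  show "\<phi> (p - q) = \<phi> p - \<phi> q" using add[of p "- q"] minus by simp
  show "\<phi> (p ^ n) = \<phi> p ^ n" by (induction n) (simp_all add: one mult)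
qed

definition poly_ext :: "('a::comm_ring_1 \<Rightarrow> 'b::comm_ring_1) \<Rightarrow> 'b \<Rightarrow> 'a poly \<Rightarrow> 'b"
  where "poly_ext \<phi> a p = poly (map_poly \<phi> p) a"

lemma poly_ext_pCons:
  assumes "is_ring_hom \<phi>"
  shows "poly_ext \<phi> a (pCons c p) = \<phi> c + a * poly_ext \<phi> a p"
  using is_ring_homD(4)[OF assms] by (simp add: poly_ext_def map_poly_pCons)

lemma is_ring_hom_poly_ext:
  assumes h: "is_ring_hom \<phi>"
  shows "is_ring_hom (poly_ext \<phi> a)"
proof -
  note [simp] = is_ring_homD[OF h] poly_ext_pCons[OF h]
  have zero [simp]: "poly_ext \<phi> a 0 = 0" by (simp add: poly_ext_def)
  have add [simp]: "poly_ext \<phi> a (p + q) = poly_ext \<phi> a p + poly_ext \<phi> a q" for p q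
    by (induction p q rule: poly_induct2) (simp_all add: algebra_simps)
  have smult [simp]: "poly_ext \<phi> a (smult c q) = \<phi> c * poly_ext \<phi> a q" for c q
    by (induction q) (simp_all add: algebra_simps)
  have mult: "poly_ext \<phi> a (p * q) = poly_ext \<phi> a p * poly_ext \<phi> a q" for p q
    by (induction p) (simp_all add: algebra_simps mult_pCons_left)
  show ?thesis using mult by (simp add: is_ring_hom_def one_pCons)
qed

definition subst3 :: "('k::comm_ring_1 \<Rightarrow> 'r::comm_ring_1) \<Rightarrow> 'r \<Rightarrow> 'r \<Rightarrow> 'r \<Rightarrow> 'k poly3 \<Rightarrow> 'r"
  where "subst3 \<phi> a b c = poly_ext (poly_ext (poly_ext \<phi> a) b) c"

lemma is_ring_hom_subst3: "is_ring_hom \<phi> \<Longrightarrow> is_ring_hom (subst3 \<phi> a b c)"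
  by (simp add: subst3_def is_ring_hom_poly_ext)

lemma subst3_gen [simp]:
  assumes "is_ring_hom \<phi>"
  shows "subst3 \<phi> a b c (Const k) = \<phi> k" "subst3 \<phi> a b c varX = a"
    "subst3 \<phi> a b c varY = b" "subst3 \<phi> a b c varZ = c"
proof -
  note h = assms is_ring_hom_poly_ext[OF assms] is_ring_hom_poly_ext[OF is_ring_hom_poly_ext[OF assms]]
  note [simp] = h poly_ext_pCons[OF h(1)] poly_ext_pCons[OF h(2)] poly_ext_pCons[OF h(3)]
    is_ring_homD(3,4)[OF h(1)] is_ring_homD(3,4)[OF h(2)] is_ring_homD(3,4)[OF h(3)]
    is_ring_homD(3,4)[OF is_ring_hom_poly_ext[OF h(3)]]
  show "subst3 \<phi> a b c (Const k) = \<phi> k" "subst3 \<phi> a b c varX = a"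
    "subst3 \<phi> a b c varY = b" "subst3 \<phi> a b c varZ = c"
    by (simp_all add: subst3_def Const_def varX_def varY_def varZ_def)
qed

lemma is_ring_hom_Const [simp]: "is_ring_hom (Const :: 'k::comm_ring_1 \<Rightarrow> 'k poly3)"
  by (simp add: is_ring_hom_def Const_def one_pCons)

lemmas Const_hom = is_ring_homD[OF is_ring_hom_Const]

lemma Const_eq_0_iff [simp]: "Const c = 0 \<longleftrightarrow> c = 0"
  by (simp add: Const_def)

text \<open>
  The recursion through the three nested coefficient rings is done once, here: it reduces statements
  about homomorphisms and derivations to constants and variables.
\<close>

lemma poly3_induct [case_names Const X Y Z add mult]:
  assumes "\<And>c. P (Const c)" "P varX" "P varY" "P varZ"
    and add: "\<And>p q. P p \<Longrightarrow> P q \<Longrightarrow> P (p + q)"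
    and mult: "\<And>p q. P p \<Longrightarrow> P q \<Longrightarrow> P (p * q)"
  shows "P (p :: 'k::comm_ring_1 poly3)"
proof -
  have 1: "P [:[:r:]:]" for r
  proof (induction r)
    case 0 show ?case using assms(1)[of 0] by (simp add: Const_def)
  next
    case (pCons c r)
    have "[:[:pCons c r:]:] = Const c + varX * [:[:r:]:]"
      by (simp add: Const_def varX_def)
    then show ?case using assms(1,2) add mult pCons by metis
  qed
  have 2: "P [:q:]" for q
  proof (induction q)
    case 0 show ?case using 1[of 0] by simp
  next
    case (pCons c r)
    have "[:pCons c r:] = [:[:c:]:] + varY * [:r:]"
      by (simp add: varY_def)
    then show ?case using 1 assms(3) add mult pCons by metis
  qed
  show ?thesis
  proof (induction p)
    case 0 show ?case using 2[of 0] by simp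
  next
    case (pCons c r)
    have "pCons c r = [:c:] + varZ * r" by (simp add: varZ_def)
    then show ?case using 2 assms(4) add mult pCons by metis
  qed
qed

text \<open>
  Taylor expansion of order zero: a polynomial differs from its value under a substitution by a combination
  of the differences between the variables and their values. This turns ideal membership into a matter of
  evaluation below.
\<close>

lemma subst3_Taylor:
  "\<exists>s t r. p = subst3 Const a b c p + (varX - a) * s + (varY - b) * t + (varZ - c) * r"
proof (induction p rule: poly3_induct)
  note [simp] = is_ring_homD(1,2)[OF is_ring_hom_subst3[OF is_ring_hom_Const]]
  { case (Const k) show ?case by (intro exI[of _ 0]) simp
  next case X show ?case by (intro exI[of _ 1] exI[of _ 0]) simp
  next case Y show ?case by (intro exI[of _ 1] exI[of _ 0]) simp
  next case Z show ?case by (intro exI[of _ 1] exI[of _ 0]) simp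
  next
    case (add p q)
    define P Q where "P = subst3 Const a b c p" and "Q = subst3 Const a b c q"
    from add obtain s t r s' t' r'
      where 1: "p = P + (varX - a) * s + (varY - b) * t + (varZ - c) * r"
        and 2: "q = Q + (varX - a) * s' + (varY - b) * t' + (varZ - c) * r'"
      unfolding P_def Q_def by blast
    have "p + q = P + Q + (varX - a) * (s + s') + (varY - b) * (t + t') + (varZ - c) * (r + r')"
      by (subst 1, subst 2) (simp add: algebra_simps)
    moreover have "subst3 Const a b c (p + q) = P + Q" by (simp add: P_def Q_def)
    ultimately show ?case by metis
  next
    case (mult p q)
    define P Q where "P = subst3 Const a b c p" and "Q = subst3 Const a b c q"
    from mult obtain s t r s' t' r'
      where 1: "p = P + (varX - a) * s + (varY - b) * t + (varZ - c) * r"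
        and 2: "q = Q + (varX - a) * s' + (varY - b) * t' + (varZ - c) * r'"
      unfolding P_def Q_def by blast
    have "p * q = (P + (varX - a) * s + (varY - b) * t + (varZ - c) * r) * q"
      using 1 by (rule arg_cong)
    also have "\<dots> = P * q + ((varX - a) * s + (varY - b) * t + (varZ - c) * r) * q"
      by (simp only: distrib_right add.assoc)
    also have "\<dots> = P * (Q + (varX - a) * s' + (varY - b) * t' + (varZ - c) * r')
        + ((varX - a) * s + (varY - b) * t + (varZ - c) * r) * q"
      using 2 by (rule arg_cong)
    also have "\<dots> = P * Q + (varX - a) * (P * s' + s * q) + (varY - b) * (P * t' + t * q)
        + (varZ - c) * (P * r' + r * q)" by (simp add: algebra_simps)
    finally have "p * q = P * Q + (varX - a) * (P * s' + s * q) + (varY - b) * (P * t' + t * q)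
        + (varZ - c) * (P * r' + r * q)" .
    moreover have "subst3 Const a b c (p * q) = P * Q" by (simp add: P_def Q_def)
    ultimately show ?case by metis
  }
qed

section \<open>Regular sequences of length three\<close>

text \<open>
  Coprimality is expressed by cancellation, that is, as regularity of the sequence \<open>k, l\<close>, because this is
  the form in which the Koszul argument uses it.
\<close>

definition coprime_pair :: "'a::idom \<Rightarrow> 'a \<Rightarrow> bool"
  where "coprime_pair k l \<longleftrightarrow> k \<noteq> 0 \<and> l \<noteq> 0 \<and> (\<forall>s. l dvd k * s \<longrightarrow> l dvd s)"

definition in_ideal2 :: "'a::idom \<Rightarrow> 'a \<Rightarrow> 'a \<Rightarrow> bool"
  where "in_ideal2 k l u \<longleftrightarrow> (\<exists>s t. u = k * s + l * t)"

definition nzd_mod :: "'a::idom \<Rightarrow> 'a \<Rightarrow> 'a \<Rightarrow> bool"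
  where "nzd_mod k l h \<longleftrightarrow> (\<forall>u. in_ideal2 k l (h * u) \<longrightarrow> in_ideal2 k l u)"

lemma coprime_pair_sym: "coprime_pair k l \<Longrightarrow> coprime_pair l k"
  unfolding coprime_pair_def
proof safe
  fix s assume k: "k \<noteq> 0" and l: "l \<noteq> 0" and cop: "\<forall>s. l dvd k * s \<longrightarrow> l dvd s" and dvd: "k dvd l * s"
  from dvd obtain r where r: "l * s = k * r" ..
  then have "l dvd k * r" by (metis dvd_triv_left)
  then have "l dvd r" using cop by blast
  then obtain r' where "r = l * r'" ..
  with r l have "s = k * r'" by simp
  then show "k dvd s" by simp
qed

lemma coprime_pair_mult: "coprime_pair k l \<Longrightarrow> coprime_pair k' l \<Longrightarrow> coprime_pair (k * k') l"
proof -
  assume k: "coprime_pair k l" and k': "coprime_pair k' l"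
  have "l dvd s" if "l dvd k * k' * s" for s
  proof -
    have "l dvd k * (k' * s)" using that by (simp only: mult.assoc)
    then have "l dvd k' * s" using k unfolding coprime_pair_def by blast
    then show ?thesis using k' unfolding coprime_pair_def by blast
  qed
  moreover have "k * k' \<noteq> 0" "l \<noteq> 0" using k k' unfolding coprime_pair_def by (blast dest: mult_eq_0_iff[THEN iffD1])+
  ultimately show ?thesis unfolding coprime_pair_def by blast
qed

lemma coprime_pair_power_left: "coprime_pair k l \<Longrightarrow> coprime_pair (k ^ a) l"
proof (induction a)
  case 0
  then have "l \<noteq> 0" unfolding coprime_pair_def by blast
  then show ?case by (simp add: coprime_pair_def)
next
  case (Suc a) then show ?case by (simp add: coprime_pair_mult)
qed

lemma coprime_pair_power: "coprime_pair k l \<Longrightarrow> coprime_pair (k ^ a) (l ^ b)"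
  by (rule coprime_pair_sym[OF coprime_pair_power_left[OF coprime_pair_sym[OF coprime_pair_power_left]]])

lemma in_ideal2_sym: "in_ideal2 k l u \<longleftrightarrow> in_ideal2 l k u"
  unfolding in_ideal2_def by (metis add.commute)

lemma nzd_mod_sym: "nzd_mod k l h \<longleftrightarrow> nzd_mod l k h"
  unfolding nzd_mod_def using in_ideal2_sym[of k l] by presburger

lemma nzd_mod_mult: "nzd_mod k l h \<Longrightarrow> nzd_mod k l h' \<Longrightarrow> nzd_mod k l (h * h')"
  unfolding nzd_mod_def by (metis mult.assoc)

lemma nzd_mod_power: "nzd_mod k l h \<Longrightarrow> nzd_mod k l (h ^ n)"
proof (induction n)
  case 0 show ?case by (simp add: nzd_mod_def)
next
  case (Suc n) then show ?case by (simp add: nzd_mod_mult)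
qed

text \<open>
  Regularity of \<open>k, l, h\<close> and \<open>k', l, h\<close> gives regularity of \<open>k * k', l, h\<close>: an element \<open>u\<close> with \<open>h * u\<close> in the
  ideal of \<open>k * k'\<close> and \<open>l\<close> is first divided by \<open>k\<close> modulo \<open>l\<close>, and the quotient then by \<open>k'\<close>. Thus powers of
  linear forms form regular sequences as soon as the forms themselves do.
\<close>

lemma nzd_mod_mult_left:
  assumes cop: "coprime_pair k l" and k: "nzd_mod k l h" and k': "nzd_mod k' l h"
  shows "nzd_mod (k * k') l h"
  unfolding nzd_mod_def
proof safe
  fix u assume "in_ideal2 (k * k') l (h * u)"
  then obtain s t where st: "h * u = k * k' * s + l * t" unfolding in_ideal2_def by blast
  then have "in_ideal2 k l (h * u)" unfolding in_ideal2_def mult.assoc by blast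
  then have "in_ideal2 k l u" using k unfolding nzd_mod_def by blast
  then obtain s1 t1 where u: "u = k * s1 + l * t1" unfolding in_ideal2_def by blast
  have "k * (h * s1 - k' * s) = l * (t - h * t1)" using st u by (simp add: algebra_simps)
  then have "l dvd h * s1 - k' * s" using cop by (metis coprime_pair_def dvd_triv_left)
  then obtain r where "h * s1 - k' * s = l * r" ..
  then have "h * s1 = k' * s + l * r" by (simp add: algebra_simps)
  then have "in_ideal2 k' l (h * s1)" unfolding in_ideal2_def by blast
  then have "in_ideal2 k' l s1" using k' unfolding nzd_mod_def by blast
  then obtain s2 t2 where "s1 = k' * s2 + l * t2" unfolding in_ideal2_def by blast
  then have "u = (k * k') * s2 + l * (k * t2 + t1)" using u by (simp add: algebra_simps)
  then show "in_ideal2 (k * k') l u" unfolding in_ideal2_def by blast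
qed

lemma nzd_mod_power_left:
  assumes "coprime_pair k l" "nzd_mod k l h"
  shows "nzd_mod (k ^ a) l h"
proof (induction a)
  case 0
  have "in_ideal2 1 l u" for u unfolding in_ideal2_def by (intro exI[of _ u] exI[of _ 0]) simp
  then show ?case by (simp add: nzd_mod_def)
next
  case (Suc a) then show ?case using nzd_mod_mult_left[OF assms] by simp
qed

lemma nzd_mod_powers:
  assumes "coprime_pair k l" "nzd_mod k l h"
  shows "nzd_mod (k ^ a) (l ^ b) h"
proof -
  have "nzd_mod l (k ^ a) h"
    using nzd_mod_power_left[OF assms] by (rule nzd_mod_sym[THEN iffD1])
  then have "nzd_mod (l ^ b) (k ^ a) h"
    by (rule nzd_mod_power_left[OF coprime_pair_sym[OF coprime_pair_power_left[OF assms(1)]]])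
  then show ?thesis by (rule nzd_mod_sym[THEN iffD1])
qed

text \<open>
  Exactness of the Koszul complex in the middle: every syzygy of a regular sequence of length three is a
  combination of the trivial ones.
\<close>

lemma Koszul_exact:
  assumes cop: "coprime_pair l\<^sub>1 l\<^sub>2" and reg: "nzd_mod l\<^sub>1 l\<^sub>2 l\<^sub>3"
    and rel: "l\<^sub>1 * a - l\<^sub>2 * b + l\<^sub>3 * c = 0"
  shows "\<exists>s\<^sub>1 s\<^sub>2 s\<^sub>3. a = l\<^sub>2 * s\<^sub>3 - l\<^sub>3 * s\<^sub>2 \<and> b = l\<^sub>1 * s\<^sub>3 - l\<^sub>3 * s\<^sub>1 \<and> c = l\<^sub>1 * s\<^sub>2 - l\<^sub>2 * s\<^sub>1"
proof -
  have "l\<^sub>3 * c = l\<^sub>1 * (- a) + l\<^sub>2 * b" using rel by algebra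
  then have "in_ideal2 l\<^sub>1 l\<^sub>2 c" using reg unfolding nzd_mod_def in_ideal2_def by blast
  then obtain s t where c: "c = l\<^sub>1 * s + l\<^sub>2 * t" unfolding in_ideal2_def by blast
  have eq: "l\<^sub>1 * (a + l\<^sub>3 * s) = l\<^sub>2 * (b - l\<^sub>3 * t)" using rel c by algebra
  then have "l\<^sub>2 dvd a + l\<^sub>3 * s" using cop by (metis coprime_pair_def dvd_triv_left)
  then obtain r where r: "a + l\<^sub>3 * s = l\<^sub>2 * r" ..
  then have "l\<^sub>2 * (l\<^sub>1 * r) = l\<^sub>2 * (b - l\<^sub>3 * t)" using eq by (simp add: algebra_simps)
  moreover have "l\<^sub>2 \<noteq> 0" using cop by (simp add: coprime_pair_def)
  ultimately have b: "l\<^sub>1 * r = b - l\<^sub>3 * t" by simp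
  show ?thesis
    by (rule exI[of _ "- t"], rule exI[of _ s], rule exI[of _ r]) (use r b c in algebra)
qed

section \<open>Derivations\<close>

interpretation der: module der_scale by (rule module_der_scale)

lemma DerD:
  assumes "\<theta> \<in> Der"
  shows "\<theta> (p + q) = \<theta> p + \<theta> q" "\<theta> (p * q) = \<theta> p * q + p * \<theta> q"
    "\<theta> (Const c * p) = Const c * \<theta> p" "\<theta> (Const c) = 0" "\<theta> (p - q) = \<theta> p - \<theta> q"
proof -
  show add: "\<theta> (p + q) = \<theta> p + \<theta> q" for p q using assms by (simp add: Der_def)
  show mult: "\<theta> (p * q) = \<theta> p * q + p * \<theta> q" for p q using assms by (simp add: Der_def)
  show const: "\<theta> (Const c * p) = Const c * \<theta> p" for c p using assms unfolding Der_def by blast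
  have "\<theta> 1 = 0" using mult[of 1 1] by simp
  then show "\<theta> (Const c) = 0" for c using const[of c 1] by simp
  show "\<theta> (p - q) = \<theta> p - \<theta> q" using add[of "p - q" q] by simp
qed

lemma Der_eqI:
  assumes \<theta>: "\<theta> \<in> Der" and \<eta>: "\<eta> \<in> Der"
    and eq: "\<theta> varX = \<eta> varX" "\<theta> varY = \<eta> varY" "\<theta> varZ = \<eta> varZ"
  shows "\<theta> = \<eta>"
proof
  fix p show "\<theta> p = \<eta> p"
    by (induction p rule: poly3_induct) (simp_all add: eq DerD[OF \<theta>] DerD[OF \<eta>])
qed

lemma subspace_Der: "der.subspace Der"
  by (rule der.subspaceI) (auto simp: Der_def der_scale_def algebra_simps)

lemma subspace_multi_der: "der.subspace (multi_der A m)"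
  using der.subspace_add[OF subspace_Der] der.subspace_scale[OF subspace_Der] der.subspace_0[OF subspace_Der]
  by (intro der.subspaceI) (auto simp: multi_der_def der_scale_def)

definition is_derivation :: "('a::comm_ring_1 \<Rightarrow> 'a) \<Rightarrow> bool"
  where "is_derivation d \<longleftrightarrow> (\<forall>p q. d (p + q) = d p + d q) \<and> (\<forall>p q. d (p * q) = d p * q + p * d q)"

lemma is_derivation_pderiv: "is_derivation (pderiv :: 'a::idom poly \<Rightarrow> 'a poly)"
  by (simp add: is_derivation_def pderiv_add pderiv_mult algebra_simps)

text \<open>
  A derivation of the coefficient ring acts on polynomials coefficientwise as a derivation. Applied to
  \<open>pderiv\<close> at the inner levels, this shows that the partial derivatives are derivations.
\<close>

lemma is_derivation_map_poly:
  assumes "is_derivation d"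
  shows "is_derivation (map_poly d)"
proof -
  have add: "d (p + q) = d p + d q" and mult: "d (p * q) = d p * q + p * d q" for p q
    using assms by (simp_all add: is_derivation_def)
  have zero [simp]: "d 0 = 0" using add[of 0 0] by simp
  have sum: "d (sum f A) = (\<Sum>i\<in>A. d (f i))" for f and A :: "nat set"
    by (induction A rule: infinite_finite_induct) (simp_all add: add)
  show ?thesis unfolding is_derivation_def
    by (auto simp: poly_eq_iff coeff_map_poly coeff_mult sum add mult sum.distrib)
qed

lemma DerI:
  assumes "is_derivation \<theta>" "\<And>c. \<theta> (Const c) = 0"
  shows "\<theta> \<in> Der"
  using assms by (simp add: Der_def is_derivation_def)

lemma partial_Der: "partialX \<in> Der" "partialY \<in> Der" "partialZ \<in> Der"
  unfolding partialX_def partialY_def partialZ_def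
  by (rule DerI, intro is_derivation_map_poly is_derivation_pderiv,
      simp add: Const_def map_poly_pCons pderiv_pCons)+

definition mk_der :: "'k::field poly3 \<Rightarrow> 'k poly3 \<Rightarrow> 'k poly3 \<Rightarrow> 'k poly3 \<Rightarrow> 'k poly3"
  where "mk_der a b c = der_scale a partialX + der_scale b partialY + der_scale c partialZ"

lemma mk_der_Der: "mk_der a b c \<in> Der"
  unfolding mk_der_def
  by (intro der.subspace_add[OF subspace_Der] der.subspace_scale[OF subspace_Der] partial_Der)

lemma mk_der_var [simp]:
  "mk_der a b c varX = a" "mk_der a b c varY = b" "mk_der a b c varZ = c"
  by (simp_all add: mk_der_def der_scale_def partial_var)

lemma mk_der_eq: "\<theta> \<in> Der \<Longrightarrow> \<theta> = mk_der (\<theta> varX) (\<theta> varY) (\<theta> varZ)"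
  by (rule Der_eqI) (simp_all add: mk_der_Der)

section \<open>Depth of a free module of derivations\<close>

lemma der_scale_apply [simp]: "der_scale f \<theta> p = f * \<theta> p"
  by (simp add: der_scale_def)

lemma sum_fun_apply: "(\<Sum>i\<in>A. f i) p = (\<Sum>i\<in>A. f i p)"
  for f :: "'i \<Rightarrow> 'a \<Rightarrow> 'b::comm_monoid_add"
  by (induction A rule: infinite_finite_induct) simp_all

lemma Der_torsion_free:
  fixes l :: "'k::field poly3"
  assumes "l \<noteq> 0" "der_scale l \<theta> \<in> Der"
  shows "\<theta> \<in> Der"
proof -
  have "l * \<theta> (p + q) = l * (\<theta> p + \<theta> q)" "l * \<theta> (p * q) = l * (\<theta> p * q + p * \<theta> q)"
    "l * \<theta> (Const c * p) = l * (Const c * \<theta> p)" for p q c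
    using DerD(1,2)[OF assms(2), of p q] DerD(3)[OF assms(2), of c p]
    by (simp_all only: der_scale_apply distrib_left mult_ac)
  then show ?thesis unfolding mult_left_cancel[OF assms(1)] Der_def by blast
qed

text \<open>
  Syzygies with values in a free module are Koszul syzygies too, since the coordinates with respect to a
  basis can be treated one at a time. Only finitely many coordinates are nonzero, so the solutions found for
  them add up to elements of the module.
\<close>

lemma free_syzygies:
  fixes B :: "('k::field poly3 \<Rightarrow> 'k poly3) set"
  assumes B: "\<not> der.dependent B"
    and cop: "coprime_pair l\<^sub>1 l\<^sub>2" and reg: "nzd_mod l\<^sub>1 l\<^sub>2 l\<^sub>3"
    and M: "d\<^sub>2\<^sub>3 \<in> der.span B" "d\<^sub>1\<^sub>3 \<in> der.span B" "d\<^sub>1\<^sub>2 \<in> der.span B"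
    and rel: "der_scale l\<^sub>1 d\<^sub>2\<^sub>3 - der_scale l\<^sub>2 d\<^sub>1\<^sub>3 + der_scale l\<^sub>3 d\<^sub>1\<^sub>2 = 0"
  shows "\<exists>s\<^sub>1\<in>der.span B. \<exists>s\<^sub>2\<in>der.span B. \<exists>s\<^sub>3\<in>der.span B.
    d\<^sub>2\<^sub>3 = der_scale l\<^sub>2 s\<^sub>3 - der_scale l\<^sub>3 s\<^sub>2 \<and> d\<^sub>1\<^sub>3 = der_scale l\<^sub>1 s\<^sub>3 - der_scale l\<^sub>3 s\<^sub>1 \<and>
    d\<^sub>1\<^sub>2 = der_scale l\<^sub>1 s\<^sub>2 - der_scale l\<^sub>2 s\<^sub>1"
proof -
  let ?R = "der.representation B"
  have "\<exists>s\<^sub>1 s\<^sub>2 s\<^sub>3. ?R d\<^sub>2\<^sub>3 b = l\<^sub>2 * s\<^sub>3 - l\<^sub>3 * s\<^sub>2 \<and> ?R d\<^sub>1\<^sub>3 b = l\<^sub>1 * s\<^sub>3 - l\<^sub>3 * s\<^sub>1 \<and>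
      ?R d\<^sub>1\<^sub>2 b = l\<^sub>1 * s\<^sub>2 - l\<^sub>2 * s\<^sub>1" for b
  proof (rule Koszul_exact[OF cop reg])
    have "?R (der_scale l\<^sub>1 d\<^sub>2\<^sub>3 - der_scale l\<^sub>2 d\<^sub>1\<^sub>3 + der_scale l\<^sub>3 d\<^sub>1\<^sub>2) b = 0"
      unfolding rel by (simp add: der.representation_zero)
    then show "l\<^sub>1 * ?R d\<^sub>2\<^sub>3 b - l\<^sub>2 * ?R d\<^sub>1\<^sub>3 b + l\<^sub>3 * ?R d\<^sub>1\<^sub>2 b = 0"
      using B M by (simp add: der.representation_add der.representation_diff der.representation_scale
          der.span_diff der.span_scale)
  qed
  then obtain \<sigma>\<^sub>1 \<sigma>\<^sub>2 \<sigma>\<^sub>3 where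
    "\<And>b. ?R d\<^sub>2\<^sub>3 b = l\<^sub>2 * \<sigma>\<^sub>3 b - l\<^sub>3 * \<sigma>\<^sub>2 b"
    "\<And>b. ?R d\<^sub>1\<^sub>3 b = l\<^sub>1 * \<sigma>\<^sub>3 b - l\<^sub>3 * \<sigma>\<^sub>1 b"
    "\<And>b. ?R d\<^sub>1\<^sub>2 b = l\<^sub>1 * \<sigma>\<^sub>2 b - l\<^sub>2 * \<sigma>\<^sub>1 b"
    by metis
  then have \<sigma>: "?R d\<^sub>2\<^sub>3 = (\<lambda>b. l\<^sub>2 * \<sigma>\<^sub>3 b - l\<^sub>3 * \<sigma>\<^sub>2 b)"
    "?R d\<^sub>1\<^sub>3 = (\<lambda>b. l\<^sub>1 * \<sigma>\<^sub>3 b - l\<^sub>3 * \<sigma>\<^sub>1 b)"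
    "?R d\<^sub>1\<^sub>2 = (\<lambda>b. l\<^sub>1 * \<sigma>\<^sub>2 b - l\<^sub>2 * \<sigma>\<^sub>1 b)"
    by blast+
  define F where "F = {b. ?R d\<^sub>2\<^sub>3 b \<noteq> 0} \<union> {b. ?R d\<^sub>1\<^sub>3 b \<noteq> 0} \<union> {b. ?R d\<^sub>1\<^sub>2 b \<noteq> 0}"
  have fin: "finite F" by (simp add: F_def der.finite_representation)
  have FB: "F \<subseteq> B" using der.representation_ne_zero by (auto simp: F_def)
  define comb where "comb \<sigma> = (\<Sum>b\<in>F. der_scale (\<sigma> b) b)" for \<sigma>
  have expand: "d = comb (?R d)" if "d \<in> {d\<^sub>2\<^sub>3, d\<^sub>1\<^sub>3, d\<^sub>1\<^sub>2}" for d
  proof -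
    have "d = (\<Sum>b | ?R d b \<noteq> 0. der_scale (?R d b) b)"
      using der.sum_nonzero_representation_eq[OF B, of d] that M by auto
    also have "\<dots> = (\<Sum>b\<in>F. der_scale (?R d b) b)"
      using fin that by (intro sum.mono_neutral_left) (auto simp: F_def)
    finally show ?thesis by (simp only: comb_def)
  qed
  have comb: "comb \<sigma> \<in> der.span B" for \<sigma>
    unfolding comb_def using FB by (intro der.span_sum der.span_scale der.span_base) auto
  have lin: "comb (\<lambda>b. k * \<sigma> b - l * \<tau> b) = der_scale k (comb \<sigma>) - der_scale l (comb \<tau>)" for k l \<sigma> \<tau>
    by (simp add: fun_eq_iff comb_def sum_fun_apply sum_distrib_left sum_subtractf[symmetric] algebra_simps)
  show ?thesis
  proof (intro bexI conjI)
    show "d\<^sub>2\<^sub>3 = der_scale l\<^sub>2 (comb \<sigma>\<^sub>3) - der_scale l\<^sub>3 (comb \<sigma>\<^sub>2)"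
      using expand[of d\<^sub>2\<^sub>3] unfolding \<sigma>(1) lin by simp
    show "d\<^sub>1\<^sub>3 = der_scale l\<^sub>1 (comb \<sigma>\<^sub>3) - der_scale l\<^sub>3 (comb \<sigma>\<^sub>1)"
      using expand[of d\<^sub>1\<^sub>3] unfolding \<sigma>(2) lin by simp
    show "d\<^sub>1\<^sub>2 = der_scale l\<^sub>1 (comb \<sigma>\<^sub>2) - der_scale l\<^sub>2 (comb \<sigma>\<^sub>1)"
      using expand[of d\<^sub>1\<^sub>2] unfolding \<sigma>(3) lin by simp
  qed (rule comb)+
qed

text \<open>
  This is the statement that a free module \<open>M\<close> has depth three: a family that is proportional to \<open>l\<^sub>1, l\<^sub>2, l\<^sub>3\<close>
  modulo \<open>M\<close> pairwise is so globally. The differences \<open>l\<^sub>i \<theta>\<^sub>j - l\<^sub>j \<theta>\<^sub>i\<close> form a syzygy in \<open>M\<close>, hence the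
  Koszul syzygy of some \<open>s\<^sub>1, s\<^sub>2, s\<^sub>3\<close> in \<open>M\<close>, and the family \<open>\<theta>\<^sub>i - s\<^sub>i\<close> is exactly proportional to
  \<open>l\<^sub>1, l\<^sub>2, l\<^sub>3\<close>. The common factor is a derivation because \<open>Der\<close> is torsion free.
\<close>

lemma free_depth:
  fixes M :: "('k::field poly3 \<Rightarrow> 'k poly3) set"
  assumes B: "is_basis B M" and MD: "M \<subseteq> Der"
    and cop: "coprime_pair l\<^sub>1 l\<^sub>2" and reg: "nzd_mod l\<^sub>1 l\<^sub>2 l\<^sub>3"
    and D: "\<theta>\<^sub>1 \<in> Der" "\<theta>\<^sub>2 \<in> Der" "\<theta>\<^sub>3 \<in> Der"
    and M: "der_scale l\<^sub>2 \<theta>\<^sub>3 - der_scale l\<^sub>3 \<theta>\<^sub>2 \<in> M" "der_scale l\<^sub>1 \<theta>\<^sub>3 - der_scale l\<^sub>3 \<theta>\<^sub>1 \<in> M"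
      "der_scale l\<^sub>1 \<theta>\<^sub>2 - der_scale l\<^sub>2 \<theta>\<^sub>1 \<in> M"
  shows "\<exists>\<theta>\<in>Der. \<theta>\<^sub>1 - der_scale l\<^sub>1 \<theta> \<in> M \<and> \<theta>\<^sub>2 - der_scale l\<^sub>2 \<theta> \<in> M \<and> \<theta>\<^sub>3 - der_scale l\<^sub>3 \<theta> \<in> M"
proof -
  have ind: "\<not> der.dependent B" and sp: "der.span B = M" using B by (auto simp: is_basis_def)
  obtain s\<^sub>1 s\<^sub>2 s\<^sub>3 where s: "s\<^sub>1 \<in> M" "s\<^sub>2 \<in> M" "s\<^sub>3 \<in> M"
    and eq: "der_scale l\<^sub>2 \<theta>\<^sub>3 - der_scale l\<^sub>3 \<theta>\<^sub>2 = der_scale l\<^sub>2 s\<^sub>3 - der_scale l\<^sub>3 s\<^sub>2"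
      "der_scale l\<^sub>1 \<theta>\<^sub>3 - der_scale l\<^sub>3 \<theta>\<^sub>1 = der_scale l\<^sub>1 s\<^sub>3 - der_scale l\<^sub>3 s\<^sub>1"
      "der_scale l\<^sub>1 \<theta>\<^sub>2 - der_scale l\<^sub>2 \<theta>\<^sub>1 = der_scale l\<^sub>1 s\<^sub>2 - der_scale l\<^sub>2 s\<^sub>1"
    using free_syzygies[OF ind cop reg, unfolded sp, OF M]
    by (auto simp: fun_eq_iff algebra_simps)
  have nz: "l\<^sub>1 \<noteq> 0" "l\<^sub>2 \<noteq> 0" and cop': "\<And>s. l\<^sub>2 dvd l\<^sub>1 * s \<Longrightarrow> l\<^sub>2 dvd s"
    using cop unfolding coprime_pair_def by blast+
  define \<eta>\<^sub>1 \<eta>\<^sub>2 \<eta>\<^sub>3 where \<eta>: "\<eta>\<^sub>1 = \<theta>\<^sub>1 - s\<^sub>1" "\<eta>\<^sub>2 = \<theta>\<^sub>2 - s\<^sub>2" "\<eta>\<^sub>3 = \<theta>\<^sub>3 - s\<^sub>3"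
  have e12: "l\<^sub>1 * \<eta>\<^sub>2 p = l\<^sub>2 * \<eta>\<^sub>1 p" and e13: "l\<^sub>1 * \<eta>\<^sub>3 p = l\<^sub>3 * \<eta>\<^sub>1 p" for p
    using fun_cong[OF eq(3), of p] fun_cong[OF eq(2), of p] by (simp_all add: \<eta> algebra_simps)
  have "\<exists>t. \<eta>\<^sub>2 p = l\<^sub>2 * t" for p
    using cop'[of "\<eta>\<^sub>2 p"] e12[of p] by (metis dvd_def)
  then obtain \<theta> where t2: "\<And>p. \<eta>\<^sub>2 p = l\<^sub>2 * \<theta> p" by metis
  have t1: "\<eta>\<^sub>1 p = l\<^sub>1 * \<theta> p" for p
  proof -
    have "l\<^sub>2 * \<eta>\<^sub>1 p = l\<^sub>2 * (l\<^sub>1 * \<theta> p)" using e12[of p] unfolding t2 by (metis mult.left_commute)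
    then show ?thesis using nz by simp
  qed
  have t3: "\<eta>\<^sub>3 p = l\<^sub>3 * \<theta> p" for p
  proof -
    have "l\<^sub>1 * \<eta>\<^sub>3 p = l\<^sub>1 * (l\<^sub>3 * \<theta> p)" using e13[of p] unfolding t1 by (metis mult.left_commute)
    then show ?thesis using nz by simp
  qed
  have "\<eta>\<^sub>2 \<in> Der" unfolding \<eta> using D s MD by (intro der.subspace_diff[OF subspace_Der]) auto
  moreover have "\<eta>\<^sub>2 = der_scale l\<^sub>2 \<theta>" using t2 by (auto simp: fun_eq_iff)
  ultimately have "\<theta> \<in> Der" using Der_torsion_free nz by metis
  moreover have "\<theta>\<^sub>1 - der_scale l\<^sub>1 \<theta> = s\<^sub>1" "\<theta>\<^sub>2 - der_scale l\<^sub>2 \<theta> = s\<^sub>2" "\<theta>\<^sub>3 - der_scale l\<^sub>3 \<theta> = s\<^sub>3"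
    using t1 t2 t3 by (auto simp: fun_eq_iff \<eta> algebra_simps)
  ultimately show ?thesis using s by metis
qed

lemma coprime_pair_dvd_cancel:
  assumes cop: "coprime_pair l\<^sub>1 l\<^sub>2" and d: "h dvd l\<^sub>1 * x" "h dvd l\<^sub>2 * x"
  shows "h dvd x"
proof -
  have nz: "l\<^sub>1 \<noteq> 0" "l\<^sub>2 \<noteq> 0" and cop': "\<And>s. l\<^sub>2 dvd l\<^sub>1 * s \<Longrightarrow> l\<^sub>2 dvd s"
    using cop unfolding coprime_pair_def by blast+
  from d obtain g g' where g: "l\<^sub>1 * x = h * g" "l\<^sub>2 * x = h * g'" unfolding dvd_def by blast
  show ?thesis
  proof (cases "h = 0")
    case True then show ?thesis using g nz by simp
  next
    case False
    have "h * (l\<^sub>1 * g') = h * (l\<^sub>2 * g)" using g by algebra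
    then have "l\<^sub>1 * g' = l\<^sub>2 * g" using False by simp
    then have "l\<^sub>2 dvd g'" using cop' by (metis dvd_triv_left)
    then obtain k where "g' = l\<^sub>2 * k" ..
    then have "l\<^sub>2 * x = l\<^sub>2 * (h * k)" using g by (simp add: algebra_simps)
    then show ?thesis using nz by simp
  qed
qed

text \<open>
  The form in which freeness is used: an inhomogeneous system of congruences
  \<open>\<theta> (A ! i) \<equiv> v i\<close> modulo \<open>(A ! i) ^ (m ! i)\<close> is solvable as soon as its multiples by the three members of a
  regular sequence are. Solutions of the multiples are compatible modulo the module of the homogeneous
  system, so \<open>free_depth\<close> applies.
\<close>

lemma free_multi_der_lift:
  fixes A :: "'k::field poly3 list"
  assumes free: "free_multiplicity A m"
    and cop: "coprime_pair l\<^sub>1 l\<^sub>2" and reg: "nzd_mod l\<^sub>1 l\<^sub>2 l\<^sub>3"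
    and D: "\<theta>\<^sub>1 \<in> Der" "\<theta>\<^sub>2 \<in> Der" "\<theta>\<^sub>3 \<in> Der"
    and v: "\<And>i. i < length A \<Longrightarrow> (A ! i) ^ (m ! i) dvd \<theta>\<^sub>1 (A ! i) - l\<^sub>1 * v i"
      "\<And>i. i < length A \<Longrightarrow> (A ! i) ^ (m ! i) dvd \<theta>\<^sub>2 (A ! i) - l\<^sub>2 * v i"
      "\<And>i. i < length A \<Longrightarrow> (A ! i) ^ (m ! i) dvd \<theta>\<^sub>3 (A ! i) - l\<^sub>3 * v i"
  shows "\<exists>\<theta>\<in>Der. \<forall>i<length A. (A ! i) ^ (m ! i) dvd \<theta> (A ! i) - v i"
proof -
  obtain B where B: "is_basis B (multi_der A m)" using free by (auto simp: free_multiplicity_def)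
  have in_M: "der_scale k \<theta> - der_scale l \<eta> \<in> multi_der A m"
    if "\<theta> \<in> Der" "\<eta> \<in> Der" "\<And>i. i < length A \<Longrightarrow> (A ! i) ^ (m ! i) dvd \<theta> (A ! i) - l * v i"
      "\<And>i. i < length A \<Longrightarrow> (A ! i) ^ (m ! i) dvd \<eta> (A ! i) - k * v i" for k l \<theta> \<eta>
    unfolding multi_der_def
  proof safe
    show "der_scale k \<theta> - der_scale l \<eta> \<in> Der"
      using that by (intro der.subspace_diff[OF subspace_Der] der.subspace_scale[OF subspace_Der])
    fix i assume i: "i < length A"
    have "(A ! i) ^ (m ! i) dvd k * (\<theta> (A ! i) - l * v i) - l * (\<eta> (A ! i) - k * v i)"
      using that(3,4)[OF i] by (rule dvd_diff[OF dvd_mult dvd_mult])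
    then show "(A ! i) ^ (m ! i) dvd (der_scale k \<theta> - der_scale l \<eta>) (A ! i)"
      by (simp add: algebra_simps)
  qed
  have "multi_der A m \<subseteq> Der" by (auto simp: multi_der_def)
  then obtain \<theta> where \<theta>: "\<theta> \<in> Der" "\<theta>\<^sub>1 - der_scale l\<^sub>1 \<theta> \<in> multi_der A m" "\<theta>\<^sub>2 - der_scale l\<^sub>2 \<theta> \<in> multi_der A m"
    using free_depth[OF B _ cop reg D in_M[OF D(3,2) v(3,2)] in_M[OF D(3,1) v(3,1)] in_M[OF D(2,1) v(2,1)]]
    by blast
  have "(A ! i) ^ (m ! i) dvd \<theta> (A ! i) - v i" if i: "i < length A" for i
  proof (rule coprime_pair_dvd_cancel[OF cop])
    have "(A ! i) ^ (m ! i) dvd (\<theta>\<^sub>1 (A ! i) - l\<^sub>1 * v i) - (\<theta>\<^sub>1 - der_scale l\<^sub>1 \<theta>) (A ! i)"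
      using \<theta>(2) i by (intro dvd_diff[OF v(1)[OF i]]) (simp add: multi_der_def)
    then show "(A ! i) ^ (m ! i) dvd l\<^sub>1 * (\<theta> (A ! i) - v i)" by (simp add: algebra_simps)
    have "(A ! i) ^ (m ! i) dvd (\<theta>\<^sub>2 (A ! i) - l\<^sub>2 * v i) - (\<theta>\<^sub>2 - der_scale l\<^sub>2 \<theta>) (A ! i)"
      using \<theta>(3) i by (intro dvd_diff[OF v(2)[OF i]]) (simp add: multi_der_def)
    then show "(A ! i) ^ (m ! i) dvd l\<^sub>2 * (\<theta> (A ! i) - v i)" by (simp add: algebra_simps)
  qed
  then show ?thesis using \<theta>(1) by blast
qed

section \<open>The linear forms\<close>

lemma var_neq_0 [simp]: "varX \<noteq> 0" "varY \<noteq> 0" "varZ \<noteq> 0"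
  by (simp_all add: varX_def varY_def varZ_def)

text \<open>
  For linear forms \<open>k\<close> and \<open>l\<close> the substitution restricts polynomials to their common zero set, and the ideal of
  the forms is its kernel. As the substitution has values in a domain, such ideals are prime, and regularity
  of a third element is checked by a nonvanishing restriction.
\<close>

lemma in_ideal2_iff_subst3:
  assumes k: "subst3 Const a b c k = 0" and l: "subst3 Const a b c l = 0"
    and gen: "in_ideal2 k l (varX - a)" "in_ideal2 k l (varY - b)" "in_ideal2 k l (varZ - c)"
  shows "in_ideal2 k l p \<longleftrightarrow> subst3 Const a b c p = 0"
proof
  note hom = is_ring_homD[OF is_ring_hom_subst3[OF is_ring_hom_Const], of a b c]
  assume "in_ideal2 k l p"
  then obtain s t where "p = k * s + l * t" unfolding in_ideal2_def by blast
  then show "subst3 Const a b c p = 0" by (simp add: hom k l)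
next
  assume 0: "subst3 Const a b c p = 0"
  obtain s t r where p: "p = (varX - a) * s + (varY - b) * t + (varZ - c) * r"
    using subst3_Taylor[of p a b c] 0 by auto
  from gen obtain x x' y y' z z' where xyz:
    "varX - a = k * x + l * x'" "varY - b = k * y + l * y'" "varZ - c = k * z + l * z'"
    unfolding in_ideal2_def by blast
  then have "p = k * (x * s + y * t + z * r) + l * (x' * s + y' * t + z' * r)"
    unfolding p xyz by (simp add: algebra_simps)
  then show "in_ideal2 k l p" unfolding in_ideal2_def by blast
qed

lemma nzd_modI:
  fixes k l h :: "'k::field poly3"
  assumes "subst3 Const a b c k = 0" "subst3 Const a b c l = 0"
    and "in_ideal2 k l (varX - a)" "in_ideal2 k l (varY - b)" "in_ideal2 k l (varZ - c)"
    and h: "subst3 Const a b c h \<noteq> 0"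
  shows "nzd_mod k l h"
  using h unfolding nzd_mod_def in_ideal2_iff_subst3[OF assms(1-5)]
  by (simp add: is_ring_homD[OF is_ring_hom_subst3[OF is_ring_hom_Const]])

lemma in_ideal2_0 [simp]: "in_ideal2 k 0 p \<longleftrightarrow> k dvd p"
  by (auto simp: in_ideal2_def dvd_def)

lemma coprime_pairI:
  fixes k l :: "'k::field poly3"
  assumes "subst3 Const a b c l = 0" "l dvd varX - a" "l dvd varY - b" "l dvd varZ - c"
    and k: "subst3 Const a b c k \<noteq> 0" and l: "l \<noteq> 0"
  shows "coprime_pair k l"
proof -
  note hom = is_ring_homD[OF is_ring_hom_subst3[OF is_ring_hom_Const], of a b c]
  have "nzd_mod l 0 k" by (rule nzd_modI[OF assms(1)]) (use assms in \<open>simp_all add: hom\<close>)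
  moreover have "k \<noteq> 0" using k hom(4) by auto
  ultimately show ?thesis using l unfolding coprime_pair_def nzd_mod_def in_ideal2_0 by blast
qed

abbreviation formXY :: "'k::field \<Rightarrow> 'k poly3" where "formXY \<alpha> \<equiv> varX - Const \<alpha> * varY"
abbreviation formXZ :: "'k::field poly3" where "formXZ \<equiv> varX + varZ"
abbreviation formYZ :: "'k::field poly3" where "formYZ \<equiv> varY + varZ"

lemma linear_form_neq_0:
  "Const a * varX + Const b * varY + Const c * varZ = 0 \<longleftrightarrow> a = 0 \<and> b = 0 \<and> c = 0"
  by (auto simp: Const_def varX_def varY_def varZ_def)

context
  fixes \<alpha> :: "'k::field"
  assumes \<alpha>: "\<alpha> \<noteq> 0" "\<alpha> \<noteq> 1"
begin

lemma subst_nonzero: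
  "formXY \<alpha> \<noteq> 0" "formXZ \<noteq> (0 :: 'k poly3)" "formYZ \<noteq> (0 :: 'k poly3)"
  "Const \<alpha> * varY + varZ \<noteq> (0 :: 'k poly3)" "varX - Const \<alpha> * (- varZ) \<noteq> (0 :: 'k poly3)"
  "- (Const (1 / \<alpha>) * varZ) + varZ \<noteq> (0 :: 'k poly3)"
  "- (Const \<alpha> * varZ) + varZ \<noteq> (0 :: 'k poly3)"
  "- varZ - Const \<alpha> * (- varZ) \<noteq> (0 :: 'k poly3)"
  using linear_form_neq_0[of 1 "- \<alpha>" 0] linear_form_neq_0[of "1::'k" 0 1] linear_form_neq_0[of "0::'k" 1 1]
    linear_form_neq_0[of 0 \<alpha> 1] linear_form_neq_0[of 1 0 \<alpha>]
    linear_form_neq_0[of 0 0 "1 - 1 / \<alpha>"] linear_form_neq_0[of 0 0 "1 - \<alpha>"] \<alpha>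
  by (simp_all add: Const_hom algebra_simps)

lemma formXY_alt: "Const (1 / \<alpha>) * Const \<alpha> = 1" "Const \<alpha> * Const (1 / \<alpha>) = 1"
  using \<alpha> by (simp_all add: Const_hom[symmetric])

lemma coprime_forms:
  "coprime_pair (formXY \<alpha>) formXZ" "coprime_pair (formXY \<alpha>) formYZ" "coprime_pair formXZ (formYZ :: 'k poly3)"
proof -
  note hom [simp] = is_ring_homD[OF is_ring_hom_subst3[OF is_ring_hom_Const]]
  show "coprime_pair (formXY \<alpha>) formXZ"
    using subst_nonzero(1)
    by (intro coprime_pair_sym[OF coprime_pairI[of "Const \<alpha> * varY" varY varZ]])
      (simp_all add: subst_nonzero)
  show "coprime_pair (formXY \<alpha>) formYZ"
    using subst_nonzero(5)
    by (intro coprime_pairI[of varX "- varZ" varZ])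
      (simp_all add: subst_nonzero del: mult_minus_right)
  show "coprime_pair formXZ (formYZ :: 'k poly3)"
    using subst_nonzero(2) by (intro coprime_pairI[of varX "- varZ" varZ]) (simp_all add: subst_nonzero)
qed

text \<open>
  The two planes of the first two forms meet in a line on which the third form does not vanish. When all three
  forms are among the last three planes, this is where \<open>\<alpha> \<noteq> 1\<close> enters: otherwise the planes \<open>x = \<alpha> y\<close>, \<open>x = - z\<close>, \<open>y = - z\<close> would share a
  line.
\<close>

lemma nzd_forms:
  "nzd_mod (formXY \<alpha>) formXZ formYZ" "nzd_mod (formXY \<alpha>) formXZ varY"
  "nzd_mod (formXY \<alpha>) formYZ formXZ" "nzd_mod (formXY \<alpha>) formYZ varX"
  "nzd_mod formXZ formYZ (formXY \<alpha>)" "nzd_mod formXZ formYZ (varX :: 'k poly3)"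
proof -
  note hom [simp] = is_ring_homD[OF is_ring_hom_subst3[OF is_ring_hom_Const]]
  have triv: "in_ideal2 k l 0" "in_ideal2 k l l" for k l :: "'k poly3"
    unfolding in_ideal2_def by (rule exI[of _ 0], rule exI[of _ 0], simp, rule exI[of _ 0], rule exI[of _ 1], simp)
  have y: "in_ideal2 (formXY \<alpha>) formXZ (varY - (- (Const (1 / \<alpha>) * varZ)))"
    unfolding in_ideal2_def
    by (rule exI[of _ "- Const (1 / \<alpha>)"], rule exI[of _ "Const (1 / \<alpha>)"])
      (use formXY_alt in algebra)
  have a1: "nzd_mod (formXY \<alpha>) formXZ h" if "subst3 Const (- varZ) (- (Const (1 / \<alpha>) * varZ)) varZ h \<noteq> 0" for h
    by (rule nzd_modI[OF _ _ _ _ _ that]) (use y triv formXY_alt in \<open>simp_all add: mult.assoc[symmetric]\<close>)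
  show "nzd_mod (formXY \<alpha>) formXZ formYZ" "nzd_mod (formXY \<alpha>) formXZ varY"
    by (rule a1; use subst_nonzero \<alpha> in simp)+
  have x: "in_ideal2 (formXY \<alpha>) formYZ (varX - (- (Const \<alpha> * varZ)))"
    unfolding in_ideal2_def
    by (rule exI[of _ 1], rule exI[of _ "Const \<alpha>"]) (simp add: algebra_simps)
  have a2: "nzd_mod (formXY \<alpha>) formYZ h" if "subst3 Const (- (Const \<alpha> * varZ)) (- varZ) varZ h \<noteq> 0" for h
    by (rule nzd_modI[OF _ _ _ _ _ that]) (use x triv in simp_all)
  show "nzd_mod (formXY \<alpha>) formYZ formXZ" "nzd_mod (formXY \<alpha>) formYZ varX"
    by (rule a2; use subst_nonzero \<alpha> in simp)+
  have z: "in_ideal2 formXZ (formYZ :: 'k poly3) formXZ"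
    unfolding in_ideal2_def by (rule exI[of _ 1], rule exI[of _ 0]) simp
  have a3: "nzd_mod formXZ formYZ h" if "subst3 Const (- varZ) (- varZ) varZ h \<noteq> 0" for h :: "'k poly3"
    by (rule nzd_modI[OF _ _ _ _ _ that]) (use z triv in simp_all)
  show "nzd_mod formXZ formYZ (formXY \<alpha>)"
    by (rule a3) (use subst_nonzero(8) in \<open>simp del: mult_minus_right\<close>)
  show "nzd_mod formXZ formYZ (varX :: 'k poly3)"
    by (rule a3) simp
qed

end

section \<open>Inhomogeneous congruences along the arrangement\<close>

text \<open>
  The inhomogeneous system whose right hand side vanishes on the coordinate planes; with \<open>u = v = w = 0\<close> it
  defines the module of the multiarrangement (\<open>multi_der_X3_iff\<close>).
\<close>

definition X3_cong ::
    "'k::field \<Rightarrow> nat list \<Rightarrow> 'k poly3 \<Rightarrow> 'k poly3 \<Rightarrow> 'k poly3 \<Rightarrow> ('k poly3 \<Rightarrow> 'k poly3) \<Rightarrow> bool"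
  where "X3_cong \<alpha> m u v w \<theta> \<longleftrightarrow> \<theta> \<in> Der \<and>
    varX ^ (m ! 0) dvd \<theta> varX \<and> varY ^ (m ! 1) dvd \<theta> varY \<and> varZ ^ (m ! 2) dvd \<theta> varZ \<and>
    formXY \<alpha> ^ (m ! 3) dvd \<theta> varX - Const \<alpha> * \<theta> varY - u \<and>
    formXZ ^ (m ! 4) dvd \<theta> varX + \<theta> varZ - v \<and>
    formYZ ^ (m ! 5) dvd \<theta> varY + \<theta> varZ - w"

lemma all_less_6: "(\<forall>i<6. P i) \<longleftrightarrow> P 0 \<and> P 1 \<and> P 2 \<and> P 3 \<and> P 4 \<and> P (5::nat)"
  by (auto simp: All_less_Suc eval_nat_numeral)

lemma X3_cong_iff:
  "X3_cong \<alpha> m u v w \<theta> \<longleftrightarrow> \<theta> \<in> Der \<and>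
    (\<forall>i<length (X3 \<alpha>). (X3 \<alpha> ! i) ^ (m ! i) dvd \<theta> (X3 \<alpha> ! i) - [0, 0, 0, u, v, w] ! i)"
proof -
  have len: "length (X3 \<alpha>) = 6" by (simp add: X3_def)
  show ?thesis
    unfolding len all_less_6 X3_cong_def
    by (auto simp: X3_def DerD)
qed

lemma multi_der_X3_iff: "\<theta> \<in> multi_der (X3 \<alpha>) m \<longleftrightarrow> X3_cong \<alpha> m 0 0 0 \<theta>"
proof -
  have len: "length (X3 \<alpha>) = 6" by (simp add: X3_def)
  show ?thesis
    unfolding len all_less_6 X3_cong_iff multi_der_def by simp
qed

lemma X3_cong_lift:
  assumes free: "free_multiplicity (X3 \<alpha>) m"
    and cop: "coprime_pair l\<^sub>1 l\<^sub>2" and reg: "nzd_mod l\<^sub>1 l\<^sub>2 l\<^sub>3"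
    and \<theta>: "X3_cong \<alpha> m (l\<^sub>1 * u) (l\<^sub>1 * v) (l\<^sub>1 * w) \<theta>\<^sub>1" "X3_cong \<alpha> m (l\<^sub>2 * u) (l\<^sub>2 * v) (l\<^sub>2 * w) \<theta>\<^sub>2"
      "X3_cong \<alpha> m (l\<^sub>3 * u) (l\<^sub>3 * v) (l\<^sub>3 * w) \<theta>\<^sub>3"
  shows "\<exists>\<theta>. X3_cong \<alpha> m u v w \<theta>"
proof -
  have scale: "[0, 0, 0, l * u, l * v, l * w] ! i = l * [0, 0, 0, u, v, w] ! i"
    if "i < length (X3 \<alpha>)" for l and i
  proof -
    have "\<forall>i<6. [0, 0, 0, l * u, l * v, l * w] ! i = l * [0, 0, 0, u, v, w] ! i"
      unfolding all_less_6 by simp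
    then show ?thesis using that by (simp add: X3_def)
  qed
  have "\<exists>\<theta>\<in>Der. \<forall>i<length (X3 \<alpha>). (X3 \<alpha> ! i) ^ (m ! i) dvd \<theta> (X3 \<alpha> ! i) - [0, 0, 0, u, v, w] ! i"
    by (rule free_multi_der_lift[OF free cop reg, of \<theta>\<^sub>1 \<theta>\<^sub>2 \<theta>\<^sub>3])
      (use \<theta> in \<open>auto simp: X3_cong_iff scale\<close>)
  then show ?thesis unfolding X3_cong_iff by blast
qed

context
  fixes \<alpha> :: "'k::field" and m :: "nat list"
  assumes \<alpha>: "\<alpha> \<noteq> 0" "\<alpha> \<noteq> 1" and free: "free_multiplicity (X3 \<alpha>) m"
begin

text \<open>
  The right hand sides \<open>x^p\<close>, \<open>y^q\<close> and \<open>z^r\<close> in the next three lemmas are chosen so that suitable multiples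
  of the systems have evident solutions: the zero derivation after multiplication by the power of the form
  whose congruence is inhomogeneous, and a multiple of a single partial derivative for each of the other two
  multipliers. For example, a multiple of \<open>\<partial>/\<partial>x\<close> respects the congruence of \<open>y + z\<close> for free, so it is enough
  that the multiplier contains the power of \<open>x + z\<close>.
\<close>

lemma X3_cong_x: "\<exists>\<theta>. X3_cong \<alpha> m (varX ^ (m ! 0)) 0 0 \<theta>"
proof (rule X3_cong_lift[OF free])
  note forms = coprime_forms(1)[OF \<alpha>] nzd_forms(1,2)[OF \<alpha>]
  show "coprime_pair (formXY \<alpha> ^ (m ! 3)) (formXZ ^ (m ! 4))"
    by (rule coprime_pair_power[OF forms(1)])
  show "nzd_mod (formXY \<alpha> ^ (m ! 3)) (formXZ ^ (m ! 4)) (formYZ ^ (m ! 5) * varY ^ (m ! 1))"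
    by (intro nzd_mod_powers nzd_mod_mult nzd_mod_power forms)
  \<comment> \<open>a multiple of \<open>\<partial>/\<partial>y\<close> that takes the prescribed value at \<open>x - \<alpha> y\<close> and is zero at \<open>x + z\<close>\<close>
  let ?t = "Const (- 1 / \<alpha>) * (formYZ ^ (m ! 5) * varY ^ (m ! 1)) * varX ^ (m ! 0)"
  show "X3_cong \<alpha> m (formXY \<alpha> ^ (m ! 3) * varX ^ (m ! 0)) (formXY \<alpha> ^ (m ! 3) * 0) (formXY \<alpha> ^ (m ! 3) * 0) (mk_der 0 0 0)"
    by (simp add: X3_cong_def mk_der_Der)
  show "X3_cong \<alpha> m (formXZ ^ (m ! 4) * varX ^ (m ! 0)) (formXZ ^ (m ! 4) * 0) (formXZ ^ (m ! 4) * 0)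
      (mk_der (formXZ ^ (m ! 4) * varX ^ (m ! 0)) 0 0)"
    by (simp add: X3_cong_def mk_der_Der)
  have "- (Const \<alpha> * ?t) = formYZ ^ (m ! 5) * varY ^ (m ! 1) * varX ^ (m ! 0)"
    using \<alpha> by (simp add: mult.assoc[symmetric] Const_hom(2)[symmetric]) (simp add: Const_hom)
  then show "X3_cong \<alpha> m (formYZ ^ (m ! 5) * varY ^ (m ! 1) * varX ^ (m ! 0)) (formYZ ^ (m ! 5) * varY ^ (m ! 1) * 0)
      (formYZ ^ (m ! 5) * varY ^ (m ! 1) * 0) (mk_der 0 ?t 0)"
    by (simp add: X3_cong_def mk_der_Der)
qed

lemma X3_cong_y: "\<exists>\<theta>. X3_cong \<alpha> m (varY ^ (m ! 1)) 0 0 \<theta>"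
proof (rule X3_cong_lift[OF free])
  note forms = coprime_forms(2)[OF \<alpha>] nzd_forms(3,4)[OF \<alpha>]
  show "coprime_pair (formXY \<alpha> ^ (m ! 3)) (formYZ ^ (m ! 5))"
    by (rule coprime_pair_power[OF forms(1)])
  show "nzd_mod (formXY \<alpha> ^ (m ! 3)) (formYZ ^ (m ! 5)) (formXZ ^ (m ! 4) * varX ^ (m ! 0))"
    by (intro nzd_mod_powers nzd_mod_mult nzd_mod_power forms)
  let ?t = "Const (- 1 / \<alpha>) * formYZ ^ (m ! 5) * varY ^ (m ! 1)"
  show "X3_cong \<alpha> m (formXY \<alpha> ^ (m ! 3) * varY ^ (m ! 1)) (formXY \<alpha> ^ (m ! 3) * 0) (formXY \<alpha> ^ (m ! 3) * 0) (mk_der 0 0 0)"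
    by (simp add: X3_cong_def mk_der_Der)
  have "- (Const \<alpha> * ?t) = formYZ ^ (m ! 5) * varY ^ (m ! 1)"
    using \<alpha> by (simp add: mult.assoc[symmetric] Const_hom(2)[symmetric]) (simp add: Const_hom)
  then show "X3_cong \<alpha> m (formYZ ^ (m ! 5) * varY ^ (m ! 1)) (formYZ ^ (m ! 5) * 0) (formYZ ^ (m ! 5) * 0)
      (mk_der 0 ?t 0)"
    by (simp add: X3_cong_def mk_der_Der)
  show "X3_cong \<alpha> m (formXZ ^ (m ! 4) * varX ^ (m ! 0) * varY ^ (m ! 1)) (formXZ ^ (m ! 4) * varX ^ (m ! 0) * 0)
      (formXZ ^ (m ! 4) * varX ^ (m ! 0) * 0) (mk_der (formXZ ^ (m ! 4) * varX ^ (m ! 0) * varY ^ (m ! 1)) 0 0)"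
    by (simp add: X3_cong_def mk_der_Der mult.assoc)
qed

lemma X3_cong_z: "\<exists>\<theta>. X3_cong \<alpha> m 0 (varZ ^ (m ! 2)) 0 \<theta>"
proof (rule X3_cong_lift[OF free])
  note forms = coprime_forms(3)[OF \<alpha>] nzd_forms(5,6)[OF \<alpha>]
  show "coprime_pair (formXZ ^ (m ! 4)) (formYZ ^ (m ! 5) :: 'k poly3)"
    by (rule coprime_pair_power[OF forms(1)])
  show "nzd_mod (formXZ ^ (m ! 4)) (formYZ ^ (m ! 5)) (formXY \<alpha> ^ (m ! 3) * varX ^ (m ! 0))"
    by (intro nzd_mod_powers nzd_mod_mult nzd_mod_power forms)
  show "X3_cong \<alpha> m (formXZ ^ (m ! 4) * 0) (formXZ ^ (m ! 4) * varZ ^ (m ! 2)) (formXZ ^ (m ! 4) * 0) (mk_der 0 0 0)"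
    by (simp add: X3_cong_def mk_der_Der)
  show "X3_cong \<alpha> m (formYZ ^ (m ! 5) * 0) (formYZ ^ (m ! 5) * varZ ^ (m ! 2)) (formYZ ^ (m ! 5) * 0)
      (mk_der 0 0 (formYZ ^ (m ! 5) * varZ ^ (m ! 2)))"
    by (simp add: X3_cong_def mk_der_Der)
  show "X3_cong \<alpha> m (formXY \<alpha> ^ (m ! 3) * varX ^ (m ! 0) * 0) (formXY \<alpha> ^ (m ! 3) * varX ^ (m ! 0) * varZ ^ (m ! 2))
      (formXY \<alpha> ^ (m ! 3) * varX ^ (m ! 0) * 0) (mk_der (formXY \<alpha> ^ (m ! 3) * varX ^ (m ! 0) * varZ ^ (m ! 2)) 0 0)"
    by (simp add: X3_cong_def mk_der_Der mult.assoc)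
qed

end

section \<open>Restriction to lines through the origin\<close>

lemma is_ring_hom_const_poly [simp]: "is_ring_hom (\<lambda>c::'k::comm_ring_1. [:c:])"
  by (simp add: is_ring_hom_def one_pCons)

definition on_line :: "'k::comm_ring_1 \<Rightarrow> 'k \<Rightarrow> 'k \<Rightarrow> 'k poly3 \<Rightarrow> 'k poly"
  where "on_line x y z = subst3 (\<lambda>c. [:c:]) [:0, x:] [:0, y:] [:0, z:]"

definition const_coeff :: "'k::comm_ring_1 poly3 \<Rightarrow> 'k"
  where "const_coeff g = coeff (coeff (coeff g 0) 0) 0"

lemma on_line_hom: "is_ring_hom (on_line x y z)"
  unfolding on_line_def by (rule is_ring_hom_subst3) simp

lemma on_line_gen [simp]:
  "on_line x y z (Const c) = [:c:]" "on_line x y z varX = [:0, x:]"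
  "on_line x y z varY = [:0, y:]" "on_line x y z varZ = [:0, z:]"
  by (simp_all add: on_line_def)

lemmas on_line_simps [simp] = is_ring_homD[OF on_line_hom]

lemma const_coeff_gen [simp]:
  "const_coeff (Const c) = c" "const_coeff varX = 0" "const_coeff varY = 0" "const_coeff varZ = 0"
  "const_coeff 1 = 1" "const_coeff 0 = 0"
  by (simp_all add: const_coeff_def Const_def varX_def varY_def varZ_def)

lemma coeff_on_line_0: "coeff (on_line x y z g) 0 = const_coeff g"
proof (induction g rule: poly3_induct)
  case (Const c) show ?case by simp
next case X show ?case by simp
next case Y show ?case by simp
next case Z show ?case by simp
next case (add p q) then show ?case by (simp add: const_coeff_def)
next case (mult p q) then show ?case by (simp add: const_coeff_def coeff_mult_0)
qed

lemma linear_power_monom: "[:0, x:] ^ p = monom (x ^ p) p" for x :: "'k::comm_ring_1"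
  by (induction p) (simp_all add: monom_Suc smult_monom one_pCons monom_0)

lemma coeff_on_line_power:
  assumes "k \<le> p"
  shows "coeff (on_line x y z (varX ^ p * g)) k = (if k = p then x ^ p * const_coeff g else 0)"
    "coeff (on_line x y z (varY ^ p * g)) k = (if k = p then y ^ p * const_coeff g else 0)"
    "coeff (on_line x y z (varZ ^ p * g)) k = (if k = p then z ^ p * const_coeff g else 0)"
  using assms by (auto simp: linear_power_monom coeff_monom_mult coeff_on_line_0)

lemma coeff_on_line_Const: "coeff (on_line x y z (Const c * g)) k = c * coeff (on_line x y z g) k"
  by simp

lemma on_line_dvd_power:
  assumes "l ^ a dvd p" "a > 0" "on_line x y z l = 0"
  shows "on_line x y z p = 0"
proof -
  obtain h where "p = l ^ a * h" using assms(1) ..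
  then show ?thesis using assms(2,3) by (simp add: zero_power)
qed

text \<open>
  Each of the three congruences is restricted to the line where its form vanishes and where the variable
  missing from the form is zero. There it becomes an identity in one variable, whose coefficients of lowest degree
  involve only the constant terms of \<open>g\<^sub>1, g\<^sub>2, g\<^sub>3\<close>; these are the same for all three lines.
\<close>

lemma X3_cong_leading_terms:
  assumes \<theta>: "X3_cong \<alpha> m u v w \<theta>" and pos: "0 < m ! 3" "0 < m ! 4" "0 < m ! 5"
    and g: "\<theta> varX = varX ^ (m ! 0) * g\<^sub>1" "\<theta> varY = varY ^ (m ! 1) * g\<^sub>2" "\<theta> varZ = varZ ^ (m ! 2) * g\<^sub>3"
  shows "k \<le> m ! 0 \<Longrightarrow> k \<le> m ! 1 \<Longrightarrow>
      (if k = m ! 0 then \<alpha> ^ (m ! 0) * const_coeff g\<^sub>1 else 0) - (if k = m ! 1 then \<alpha> * const_coeff g\<^sub>2 else 0)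
        = coeff (on_line \<alpha> 1 0 u) k"
    and "k \<le> m ! 0 \<Longrightarrow> k \<le> m ! 2 \<Longrightarrow>
      (if k = m ! 0 then (- 1) ^ (m ! 0) * const_coeff g\<^sub>1 else 0) + (if k = m ! 2 then const_coeff g\<^sub>3 else 0)
        = coeff (on_line (- 1) 0 1 v) k"
    and "k \<le> m ! 1 \<Longrightarrow> k \<le> m ! 2 \<Longrightarrow>
      (if k = m ! 1 then (- 1) ^ (m ! 1) * const_coeff g\<^sub>2 else 0) + (if k = m ! 2 then const_coeff g\<^sub>3 else 0)
        = coeff (on_line 0 (- 1) 1 w) k"
proof -
  have d: "formXY \<alpha> ^ (m ! 3) dvd \<theta> varX - Const \<alpha> * \<theta> varY - u" "formXZ ^ (m ! 4) dvd \<theta> varX + \<theta> varZ - v"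
    "formYZ ^ (m ! 5) dvd \<theta> varY + \<theta> varZ - w"
    using \<theta> by (simp_all add: X3_cong_def)
  have e1: "on_line \<alpha> 1 0 (varX ^ (m ! 0) * g\<^sub>1) - on_line \<alpha> 1 0 (Const \<alpha> * (varY ^ (m ! 1) * g\<^sub>2)) = on_line \<alpha> 1 0 u"
    using on_line_dvd_power[OF d(1) pos(1), of \<alpha> 1 0] unfolding g on_line_simps(6) by simp
  have e2: "on_line (- 1) 0 1 (varX ^ (m ! 0) * g\<^sub>1) + on_line (- 1) 0 1 (varZ ^ (m ! 2) * g\<^sub>3) = on_line (- 1) 0 1 v"
    using on_line_dvd_power[OF d(2) pos(2), of "- 1" 0 1] unfolding g on_line_simps(1,6) by simp
  have e3: "on_line 0 (- 1) 1 (varY ^ (m ! 1) * g\<^sub>2) + on_line 0 (- 1) 1 (varZ ^ (m ! 2) * g\<^sub>3) = on_line 0 (- 1) 1 w"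
    using on_line_dvd_power[OF d(3) pos(3), of 0 "- 1" 1] unfolding g on_line_simps(1,6) by simp
  { assume k: "k \<le> m ! 0" "k \<le> m ! 1"
    show "(if k = m ! 0 then \<alpha> ^ (m ! 0) * const_coeff g\<^sub>1 else 0) - (if k = m ! 1 then \<alpha> * const_coeff g\<^sub>2 else 0)
        = coeff (on_line \<alpha> 1 0 u) k"
      unfolding e1[symmetric] coeff_diff coeff_on_line_Const coeff_on_line_power[OF k(1)] coeff_on_line_power[OF k(2)]
      by simp }
  { assume k: "k \<le> m ! 0" "k \<le> m ! 2"
    show "(if k = m ! 0 then (- 1) ^ (m ! 0) * const_coeff g\<^sub>1 else 0) + (if k = m ! 2 then const_coeff g\<^sub>3 else 0)
        = coeff (on_line (- 1) 0 1 v) k"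
      unfolding e2[symmetric] coeff_add coeff_on_line_power[OF k(1)] coeff_on_line_power[OF k(2)]
      by simp }
  { assume k: "k \<le> m ! 1" "k \<le> m ! 2"
    show "(if k = m ! 1 then (- 1) ^ (m ! 1) * const_coeff g\<^sub>2 else 0) + (if k = m ! 2 then const_coeff g\<^sub>3 else 0)
        = coeff (on_line 0 (- 1) 1 w) k"
      unfolding e3[symmetric] coeff_add coeff_on_line_power[OF k(1)] coeff_on_line_power[OF k(2)]
      by simp }
qed

lemma X3_cong_obtain:
  assumes "X3_cong \<alpha> m u v w \<theta>"
  obtains g\<^sub>1 g\<^sub>2 g\<^sub>3 where
    "\<theta> varX = varX ^ (m ! 0) * g\<^sub>1" "\<theta> varY = varY ^ (m ! 1) * g\<^sub>2" "\<theta> varZ = varZ ^ (m ! 2) * g\<^sub>3"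
  using assms unfolding X3_cong_def dvd_def by blast

lemma Der_power:
  fixes p :: "'a::comm_ring_1 poly3"
  assumes "\<theta> \<in> Der"
  shows "\<theta> (p ^ Suc k) = Const (of_nat (Suc k)) * (p ^ k * \<theta> p)"
proof (induction k)
  case 0 show ?case by (simp add: Const_hom)
next
  case (Suc k)
  have c: "Const (of_nat (Suc (Suc k)) :: 'a) = 1 + Const (of_nat (Suc k))"
    by (simp only: of_nat_Suc[of "Suc k"] Const_hom(1,3))
  have "\<theta> (p ^ Suc (Suc k)) = \<theta> p * p ^ Suc k + p * \<theta> (p ^ Suc k)"
    using DerD(2)[OF assms, of p "p ^ Suc k"] by simp
  also have "\<dots> = Const (of_nat (Suc (Suc k))) * (p ^ Suc k * \<theta> p)"
    unfolding Suc c by (simp add: algebra_simps del: of_nat_Suc)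
  finally show ?case .
qed

lemma Der_dvd_power:
  assumes "\<theta> \<in> Der" "l ^ a dvd p" "2 \<le> a"
  shows "l dvd \<theta> p"
proof -
  have "l ^ 2 dvd l ^ a" using assms(3) by (rule le_imp_power_dvd)
  then have "l ^ 2 dvd p" using assms(2) by (rule dvd_trans)
  then obtain h where "p = l * (l * h)" by (auto simp: power2_eq_square mult.assoc)
  then have "\<theta> p = l * (\<theta> l * h + \<theta> (l * h))" by (simp add: DerD[OF assms(1)] algebra_simps)
  then show ?thesis by simp
qed

lemma on_line_dvd: "l dvd p \<Longrightarrow> on_line x y z l = 0 \<Longrightarrow> on_line x y z p = 0"
  by auto

section \<open>Free multiplicities are of the form [n,n,n,1,1,1]\<close>

context
  fixes \<alpha> :: "'k::field_char_0" and m :: "nat list"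
  assumes \<alpha>: "\<alpha> \<noteq> 0" "\<alpha> \<noteq> 1" and free: "free_multiplicity (X3 \<alpha>) m"
    and pos: "0 < m ! 3" "0 < m ! 4" "0 < m ! 5"
begin

text \<open>
  If the three multiplicities are not all equal, the equations between constant terms are contradictory: on
  each line the variable of strictly smaller multiplicity has its constant term determined by the
  right hand side alone, and following these values around the triangle of the three lines
  leads to a constant term that has to be both zero and nonzero.
\<close>

lemma free_imp_variables_equal: "m ! 1 = m ! 0 \<and> m ! 2 = m ! 0"
proof -
  define p q r where "p = m ! 0" and "q = m ! 1" and "r = m ! 2"
  note pqr = p_def[symmetric] q_def[symmetric] r_def[symmetric]
  obtain \<theta> g\<^sub>1 g\<^sub>2 g\<^sub>3 where \<theta>: "X3_cong \<alpha> m (varX ^ p) 0 0 \<theta>"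
    "\<theta> varX = varX ^ p * g\<^sub>1" "\<theta> varY = varY ^ q * g\<^sub>2" "\<theta> varZ = varZ ^ r * g\<^sub>3"
    unfolding p_def q_def r_def using X3_cong_x[OF \<alpha> free] X3_cong_obtain by metis
  obtain \<eta> h\<^sub>1 h\<^sub>2 h\<^sub>3 where \<eta>: "X3_cong \<alpha> m (varY ^ q) 0 0 \<eta>"
    "\<eta> varX = varX ^ p * h\<^sub>1" "\<eta> varY = varY ^ q * h\<^sub>2" "\<eta> varZ = varZ ^ r * h\<^sub>3"
    unfolding p_def q_def r_def using X3_cong_y[OF \<alpha> free] X3_cong_obtain by metis
  obtain \<zeta> k\<^sub>1 k\<^sub>2 k\<^sub>3 where \<zeta>: "X3_cong \<alpha> m 0 (varZ ^ r) 0 \<zeta>"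
    "\<zeta> varX = varX ^ p * k\<^sub>1" "\<zeta> varY = varY ^ q * k\<^sub>2" "\<zeta> varZ = varZ ^ r * k\<^sub>3"
    unfolding p_def q_def r_def using X3_cong_z[OF \<alpha> free] X3_cong_obtain by metis
  note X = X3_cong_leading_terms[OF \<theta>(1) pos, unfolded pqr, OF \<theta>(2-4)]
  note Y = X3_cong_leading_terms[OF \<eta>(1) pos, unfolded pqr, OF \<eta>(2-4)]
  note Z = X3_cong_leading_terms[OF \<zeta>(1) pos, unfolded pqr, OF \<zeta>(2-4)]
  have c: "coeff (on_line x y z (varX ^ n)) n = x ^ n" "coeff (on_line x y z (varY ^ n)) n = y ^ n"
    "coeff (on_line x y z (varZ ^ n)) n = z ^ n" for x y z :: 'k and n
    by (simp_all add: linear_power_monom)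
  have False if "p < q"
  proof -
    have g1: "const_coeff g\<^sub>1 = 1" using X(1)[of p] that c(1)[of \<alpha> 1 0 p] \<alpha> by simp
    then have rp: "r < p" if "\<not> r < p"
      using X(2)[of p] X(3)[of r] \<open>p < q\<close> that by (cases "p = r") auto
    then have rp: "r < p" by blast
    then have "const_coeff k\<^sub>3 = 1" using Z(2)[of r] c(3)[of "- 1" 0 1 r] by simp
    moreover have "const_coeff k\<^sub>3 = 0" using Z(3)[of r] rp that by simp
    ultimately show False by simp
  qed
  moreover have False if "q < p"
  proof -
    have "const_coeff h\<^sub>2 \<noteq> 0" using Y(1)[of q] that c(2)[of \<alpha> 1 0 q] by auto
    then have rq: "r < q" if "\<not> r < q"
      using Y(3)[of q] Y(2)[of r] \<open>q < p\<close> that by (cases "q = r") auto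
    then have rq: "r < q" by blast
    then have "const_coeff k\<^sub>3 = 1" using Z(2)[of r] c(3)[of "- 1" 0 1 r] that by simp
    moreover have "const_coeff k\<^sub>3 = 0" using Z(3)[of r] rq that by simp
    ultimately show False by simp
  qed
  ultimately have pq: "p = q" by (meson linorder_neqE_nat)
  have "\<not> r < p"
  proof
    assume "r < p"
    then have "const_coeff k\<^sub>3 = 1" using Z(2)[of r] c(3)[of "- 1" 0 1 r] by simp
    moreover have "const_coeff k\<^sub>3 = 0" using Z(3)[of r] \<open>r < p\<close> pq by simp
    ultimately show False by simp
  qed
  moreover have "\<not> p < r"
  proof
    assume "p < r"
    then have "const_coeff g\<^sub>1 = 0" using X(2)[of p] by simp
    moreover have "const_coeff g\<^sub>2 = 0" using X(3)[of p] \<open>p < r\<close> pq by simp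
    ultimately show False using X(1)[of p] pq c(1)[of \<alpha> 1 0 p] \<alpha> by simp
  qed
  ultimately show ?thesis using pq unfolding p_def q_def r_def by simp
qed

text \<open>
  For equal multiplicities \<open>n\<close>, the right hand side \<open>x^n\<close> gives the constant terms the values \<open>\<gamma>\<close>, \<open>\<gamma>\<close> and
  \<open>- (- 1)^n * \<gamma>\<close> with \<open>(\<alpha>^n - \<alpha>) * \<gamma> = \<alpha>^n\<close>. This already excludes \<open>\<alpha>^(n - 1) = 1\<close>. If the form \<open>x - \<alpha> y\<close> had
  multiplicity at least two, the derivative of its congruence with respect to \<open>x\<close> would still vanish on the line, and
  comparing coefficients there yields \<open>n * \<gamma> = n\<close>, whereas \<open>\<gamma> \<noteq> 1\<close>; for the other two forms one
  obtains \<open>n * \<gamma> = 0\<close> in the same way. Characteristic zero is needed to cancel \<open>n\<close>.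
\<close>

lemma free_imp_multiplicities:
  assumes n: "0 < m ! 0"
  shows "m ! 3 = 1 \<and> m ! 4 = 1 \<and> m ! 5 = 1 \<and> \<alpha> ^ (m ! 0 - 1) \<noteq> 1"
proof -
  obtain k where k: "m ! 0 = Suc k" using n gr0_implies_Suc by blast
  then have k': "m ! 1 = Suc k" "m ! 2 = Suc k" using free_imp_variables_equal by simp_all
  obtain \<theta> g\<^sub>1 g\<^sub>2 g\<^sub>3 where \<theta>: "X3_cong \<alpha> m (varX ^ Suc k) 0 0 \<theta>"
    "\<theta> varX = varX ^ Suc k * g\<^sub>1" "\<theta> varY = varY ^ Suc k * g\<^sub>2" "\<theta> varZ = varZ ^ Suc k * g\<^sub>3"
    using X3_cong_x[OF \<alpha> free] X3_cong_obtain k k' by metis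
  define \<gamma> where "\<gamma> = const_coeff g\<^sub>1"
  note X = X3_cong_leading_terms[OF \<theta>(1) pos, unfolded k k', OF \<theta>(2-4), of "Suc k"]
  have "(- 1) ^ Suc k * const_coeff g\<^sub>1 = (- 1) ^ Suc k * const_coeff g\<^sub>2"
    using X(2,3) by (simp add: add_eq_0_iff)
  then have g2: "const_coeff g\<^sub>2 = \<gamma>" by (simp add: \<gamma>_def)
  have eq: "\<alpha> ^ Suc k * \<gamma> - \<alpha> * \<gamma> = \<alpha> ^ Suc k"
    using X(1) g2 by (simp add: \<gamma>_def linear_power_monom del: power_Suc)
  then have \<gamma>: "\<gamma> \<noteq> 0" "\<gamma> \<noteq> 1" using \<alpha> by auto
  have \<alpha>k: "\<alpha> ^ k \<noteq> 1" using eq \<alpha> by auto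
  have dP: "\<delta> (varX ^ Suc k * g) = Const (of_nat (Suc k)) * (varX ^ k * (\<delta> varX * g)) + varX ^ Suc k * \<delta> g"
    "\<delta> (varY ^ Suc k * g) = Const (of_nat (Suc k)) * (varY ^ k * (\<delta> varY * g)) + varY ^ Suc k * \<delta> g"
    "\<delta> (varZ ^ Suc k * g) = Const (of_nat (Suc k)) * (varZ ^ k * (\<delta> varZ * g)) + varZ ^ Suc k * \<delta> g"
    if "\<delta> \<in> Der" for \<delta> and g :: "'k poly3"
    unfolding DerD(2)[OF that] Der_power[OF that] by (simp_all only: mult.assoc)
  have low: "coeff (on_line x y z (varX ^ Suc k * g)) k = 0" "coeff (on_line x y z (varY ^ Suc k * g)) k = 0"
    "coeff (on_line x y z (varZ ^ Suc k * g)) k = 0" for x y z :: 'k and g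
    by (simp_all only: coeff_on_line_power[OF le_SucI[OF order_refl]] n_not_Suc_n if_False)
  note low' = coeff_on_line_power[OF order_refl] coeff_on_line_Const low
  have d: "formXY \<alpha> ^ (m ! 3) dvd varX ^ Suc k * g\<^sub>1 - Const \<alpha> * (varY ^ Suc k * g\<^sub>2) - varX ^ Suc k * 1"
    "formXZ ^ (m ! 4) dvd varX ^ Suc k * g\<^sub>1 + varZ ^ Suc k * g\<^sub>3"
    "formYZ ^ (m ! 5) dvd varY ^ Suc k * g\<^sub>2 + varZ ^ Suc k * g\<^sub>3"
    using \<theta> by (simp_all only: X3_cong_def diff_zero mult_1_right)
  have n0: "of_nat (Suc k) \<noteq> (0::'k)" by (simp only: of_nat_eq_0_iff nat.distinct not_False_eq_True)
  note ring = on_line_simps(1,6) coeff_add coeff_diff coeff_0 DerD(1,3,5)[OF partial_Der(1)] DerD(1,3,5)[OF partial_Der(2)]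
  have "m ! 3 \<le> 1"
  proof (rule ccontr)
    assume "\<not> m ! 3 \<le> 1"
    then have "2 \<le> m ! 3" by simp
    note Der_dvd_power[OF partial_Der(1) d(1) this]
    from on_line_dvd[OF this, of \<alpha> 1 0]
    have "coeff (on_line \<alpha> 1 0 (partialX (varX ^ Suc k * g\<^sub>1 - Const \<alpha> * (varY ^ Suc k * g\<^sub>2) - varX ^ Suc k * 1))) k = 0"
      by simp
    then have "of_nat (Suc k) * (\<alpha> ^ k * \<gamma>) = of_nat (Suc k) * (\<alpha> ^ k * 1)"
      unfolding ring dP[OF partial_Der(1)] partial_var low' mult_1_left mult_zero_left mult_zero_right
      by (simp add: \<gamma>_def const_coeff_def del: of_nat_Suc)
    then show False using n0 \<gamma> \<alpha> by (simp del: of_nat_Suc)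
  qed
  moreover have "m ! 4 \<le> 1"
  proof (rule ccontr)
    assume "\<not> m ! 4 \<le> 1"
    then have "2 \<le> m ! 4" by simp
    note Der_dvd_power[OF partial_Der(1) d(2) this]
    from on_line_dvd[OF this, of "- 1" 0 1]
    have "coeff (on_line (- 1) 0 1 (partialX (varX ^ Suc k * g\<^sub>1 + varZ ^ Suc k * g\<^sub>3))) k = 0"
      by simp
    then have "of_nat (Suc k) * ((- 1) ^ k * \<gamma>) = 0"
      unfolding ring dP[OF partial_Der(1)] partial_var low' mult_1_left mult_zero_left mult_zero_right
      by (simp add: \<gamma>_def const_coeff_def del: of_nat_Suc)
    then show False using n0 \<gamma> by (simp del: of_nat_Suc)
  qed
  moreover have "m ! 5 \<le> 1"
  proof (rule ccontr)
    assume "\<not> m ! 5 \<le> 1"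
    then have "2 \<le> m ! 5" by simp
    note Der_dvd_power[OF partial_Der(2) d(3) this]
    from on_line_dvd[OF this, of 0 "- 1" 1]
    have "coeff (on_line 0 (- 1) 1 (partialY (varY ^ Suc k * g\<^sub>2 + varZ ^ Suc k * g\<^sub>3))) k = 0"
      by simp
    then have "of_nat (Suc k) * ((- 1) ^ k * \<gamma>) = 0"
      unfolding ring dP[OF partial_Der(2)] partial_var low' mult_1_left mult_zero_left mult_zero_right g2
      by (simp add: const_coeff_def del: of_nat_Suc)
    then show False using n0 \<gamma> by (simp del: of_nat_Suc)
  qed
  ultimately show ?thesis using pos \<alpha>k k by auto
qed

end

theorem free_X3_imp:
  fixes \<alpha> :: "'k::field_char_0"
  assumes \<alpha>: "\<alpha> \<noteq> 0" "\<alpha> \<noteq> 1" and len: "length m = 6" and pos: "\<forall>i<6. 0 < m ! i"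
    and free: "free_multiplicity (X3 \<alpha>) m"
  shows "\<exists>n>0. m = [n, n, n, 1, 1, 1] \<and> \<alpha> ^ (n - 1) \<noteq> 1"
proof (intro exI conjI)
  have p: "0 < m ! 0" "0 < m ! 3" "0 < m ! 4" "0 < m ! 5" using pos by auto
  show "0 < m ! 0" by (rule p)
  note a = free_imp_variables_equal[OF \<alpha> free p(2-4)] free_imp_multiplicities[OF \<alpha> free p(2-4,1)]
  show "m = [m ! 0, m ! 0, m ! 0, 1, 1, 1]"
    by (rule nth_equalityI) (use a len in \<open>auto simp: less_Suc_eq eval_nat_numeral\<close>)
  show "\<alpha> ^ (m ! 0 - 1) \<noteq> 1" using a by blast
qed

section \<open>Graded bases\<close>

abbreviation coeff3 :: "'k::zero poly poly poly \<Rightarrow> nat \<Rightarrow> nat \<Rightarrow> nat \<Rightarrow> 'k"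
  where "coeff3 p i j k \<equiv> coeff (coeff (coeff p k) j) i"

lemma poly3_eqI: "(\<And>i j k. coeff3 p i j k = coeff3 q i j k) \<Longrightarrow> p = q"
  by (simp add: poly_eq_iff)

lemma coeff3_mult:
  "coeff3 (p * q) i j k =
    (\<Sum>k'\<le>k. \<Sum>j'\<le>j. \<Sum>i'\<le>i. coeff3 p i' j' k' * coeff3 q (i - i') (j - j') (k - k'))"
  by (simp add: coeff_mult coeff_sum)

text \<open>
  Multiplication by \<open>s\<close> acts on the lowest degree part through the constant term of \<open>s\<close> alone. All degree
  arguments about homogeneous bases reduce to this.
\<close>

lemma coeff3_mult_homogeneous:
  assumes f: "homogeneous_poly e f" and le: "i + j + k \<le> e"
  shows "coeff3 (s * f) i j k = const_coeff s * coeff3 f i j k"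
proof -
  have "coeff3 s i' j' k' * coeff3 f (i - i') (j - j') (k - k')
      = (if i' = 0 then if j' = 0 then if k' = 0 then const_coeff s * coeff3 f i j k else 0 else 0 else 0)"
    if "i' \<le> i" "j' \<le> j" "k' \<le> k" for i' j' k'
  proof (cases "i' = 0 \<and> j' = 0 \<and> k' = 0")
    case True then show ?thesis by (simp add: const_coeff_def)
  next
    case False
    then have "(i - i') + (j - j') + (k - k') \<noteq> e" using that le by linarith
    then have "coeff3 f (i - i') (j - j') (k - k') = 0" using f unfolding homogeneous_poly_def by blast
    then show ?thesis using False by auto
  qed
  then have "coeff3 (s * f) i j k = (\<Sum>k'\<le>k. \<Sum>j'\<le>j. \<Sum>i'\<le>i.
      if i' = 0 then if j' = 0 then if k' = 0 then const_coeff s * coeff3 f i j k else 0 else 0 else 0)"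
    unfolding coeff3_mult by (intro sum.cong refl) simp
  also have "\<dots> = const_coeff s * coeff3 f i j k"
    by simp
  finally show ?thesis .
qed

lemma homogeneous_combination_poly:
  fixes p :: "'k::field poly3" and f :: "'b \<Rightarrow> 'k poly3"
  assumes f: "\<And>b. b \<in> T \<Longrightarrow> homogeneous_poly (e b) (f b)" and deg: "\<And>b. b \<in> T \<Longrightarrow> d \<le> e b"
    and p: "homogeneous_poly d p" and eq: "p = (\<Sum>b\<in>T. s b * f b)"
  shows "p = (\<Sum>b\<in>T. (if e b = d then Const (const_coeff (s b)) else 0) * f b)"
proof (rule poly3_eqI)
  fix i j k
  have csum: "coeff3 (\<Sum>b\<in>T. g b) i j k = (\<Sum>b\<in>T. coeff3 (g b) i j k)" for g :: "'b \<Rightarrow> 'k poly3"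
    by (simp add: coeff_sum)
  have hom: "coeff3 h i j k = 0" if "homogeneous_poly n h" "i + j + k \<noteq> n" for h :: "'k poly3" and n
    using that unfolding homogeneous_poly_def by blast
  show "coeff3 p i j k = coeff3 (\<Sum>b\<in>T. (if e b = d then Const (const_coeff (s b)) else 0) * f b) i j k"
  proof (cases "i + j + k = d")
    case True
    have "coeff3 (s b * f b) i j k = coeff3 ((if e b = d then Const (const_coeff (s b)) else 0) * f b) i j k"
      if b: "b \<in> T" for b
      using coeff3_mult_homogeneous[OF f[OF b], of i j k] deg[OF b] hom[OF f[OF b]] True by simp
    then show ?thesis unfolding eq csum by (rule sum.cong[OF refl])
  next
    case False
    have "coeff3 ((if e b = d then Const (const_coeff (s b)) else 0) * f b) i j k = 0" if b: "b \<in> T" for b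
      using hom[OF f[OF b]] False by (simp add: Const_def)
    then show ?thesis unfolding csum using hom[OF p False] by simp
  qed
qed

lemma homogeneous_der_iff:
  "homogeneous_der d \<theta> \<longleftrightarrow> \<theta> \<in> Der \<and> homogeneous_poly d (\<theta> varX) \<and> homogeneous_poly d (\<theta> varY)
    \<and> homogeneous_poly d (\<theta> varZ)"
  unfolding homogeneous_der_def mk_der_def[symmetric] using mk_der_Der mk_der_eq mk_der_var by metis

text \<open>
  In a combination of homogeneous derivations of degree at least \<open>d\<close> that is itself homogeneous of degree
  \<open>d\<close>, only the members of degree \<open>d\<close> and the constant terms of their coefficients matter.
\<close>

lemma homogeneous_combination:
  assumes T: "\<And>b. b \<in> T \<Longrightarrow> homogeneous_der (e b) b" and deg: "\<And>b. b \<in> T \<Longrightarrow> d \<le> e b"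
    and \<theta>: "homogeneous_der d \<theta>" and eq: "\<theta> = (\<Sum>b\<in>T. der_scale (s b) b)"
  shows "\<theta> = (\<Sum>b\<in>T. der_scale (if e b = d then Const (const_coeff (s b)) else 0) b)"
proof (rule Der_eqI)
  show "\<theta> \<in> Der" using \<theta> by (simp add: homogeneous_der_iff)
  show "(\<Sum>b\<in>T. der_scale (if e b = d then Const (const_coeff (s b)) else 0) b) \<in> Der"
    using T by (intro der.subspace_sum[OF subspace_Der] der.subspace_scale[OF subspace_Der])
      (auto simp: homogeneous_der_iff)
  have "\<theta> p = (\<Sum>b\<in>T. der_scale (if e b = d then Const (const_coeff (s b)) else 0) b) p"
    if p: "\<And>d \<eta>. homogeneous_der d \<eta> \<Longrightarrow> homogeneous_poly d (\<eta> p)" for p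
    using homogeneous_combination_poly[of T e "\<lambda>b. b p", OF p[OF T] deg p[OF \<theta>], of s]
      fun_cong[OF eq, of p] by (simp add: sum_fun_apply)
  note * = this
  show "\<theta> varX = (\<Sum>b\<in>T. der_scale (if e b = d then Const (const_coeff (s b)) else 0) b) varX"
    "\<theta> varY = (\<Sum>b\<in>T. der_scale (if e b = d then Const (const_coeff (s b)) else 0) b) varY"
    "\<theta> varZ = (\<Sum>b\<in>T. der_scale (if e b = d then Const (const_coeff (s b)) else 0) b) varZ"
    by (rule *, simp add: homogeneous_der_iff)+
qed

text \<open>
  Homogeneous bases generated in a single degree are compared as bases of a vector space over the field of
  constants, whose dimension theory gives the equality of their sizes.
\<close>

definition const_scale :: "'k::field \<Rightarrow> ('k poly3 \<Rightarrow> 'k poly3) \<Rightarrow> 'k poly3 \<Rightarrow> 'k poly3"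
  where "const_scale c = der_scale (Const c)"

interpretation cst: vector_space "const_scale :: 'k::field \<Rightarrow> _"
  by unfold_locales (simp_all add: const_scale_def fun_eq_iff Const_hom algebra_simps)

lemma independent_over_constants:
  assumes "finite B" "\<not> der.dependent B"
  shows "\<not> cst.dependent B"
proof
  assume "cst.dependent B"
  then obtain u where u: "\<exists>v\<in>B. u v \<noteq> 0" "(\<Sum>v\<in>B. const_scale (u v) v) = 0"
    unfolding cst.dependent_finite[OF assms(1)] by blast
  then have "der.dependent B"
    unfolding der.dependent_finite[OF assms(1)] const_scale_def by (intro exI[of _ "\<lambda>v. Const (u v)"]) simp
  then show False using assms(2) by blast
qed

text \<open>
  No member of \<open>B\<close> has degree below \<open>e\<close>, because \<open>M\<close> has no nonzero homogeneous elements there. Hence the members of \<open>T\<close>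
  are combinations, with constant coefficients, of the part of \<open>B\<close> of degree \<open>e\<close>. That part spans \<open>M\<close>, so it is all
  of \<open>B\<close> by independence, and \<open>T\<close> and \<open>B\<close> are bases of the same vector space over the constants.
\<close>

theorem homogeneous_basis_unique:
  fixes M :: "('k::field poly3 \<Rightarrow> 'k poly3) set"
  assumes T: "finite T" "is_basis T M" "\<And>b. b \<in> T \<Longrightarrow> homogeneous_der e b"
    and B: "finite B" "is_basis B M" "\<And>b. b \<in> B \<Longrightarrow> homogeneous_der (deg b) b"
  shows "card B = card T" and "\<And>b. b \<in> B \<Longrightarrow> deg b = e"
proof -
  have iT: "\<not> der.dependent T" and sT: "der.span T = M" using T(2) by (auto simp: is_basis_def)
  have iB: "\<not> der.dependent B" and sB: "der.span B = M" using B(2) by (auto simp: is_basis_def)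
  have expand: "\<exists>s. \<theta> = (\<Sum>b\<in>A. der_scale (s b) b)" if "\<theta> \<in> M" "A = T \<or> A = B" for \<theta> A
    using that T(1) B(1) sT sB der.span_finite[of A] by auto
  have BM: "b \<in> M" if "b \<in> B" for b using that sB der.span_base by blast
  have TM: "b \<in> M" if "b \<in> T" for b using that sT der.span_base by blast
  have deg_ge: "e \<le> deg b" if b: "b \<in> B" for b
  proof (rule ccontr)
    assume "\<not> e \<le> deg b"
    obtain s where "b = (\<Sum>t\<in>T. der_scale (s t) t)" using expand[OF BM[OF b], of T] by auto
    from homogeneous_combination[OF T(3) _ B(3)[OF b] this] \<open>\<not> e \<le> deg b\<close>
    have "b = (\<Sum>t\<in>T. der_scale 0 t)" by simp
    then have "b = 0" by simp
    then show False using iB b der.dependent_zero by blast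
  qed
  define B' where "B' = {b \<in> B. deg b = e}"
  have T_comb: "\<exists>c. t = (\<Sum>b\<in>B'. der_scale (Const (c b)) b)" if t: "t \<in> T" for t
  proof -
    obtain s where s: "t = (\<Sum>b\<in>B. der_scale (s b) b)" using expand[OF TM[OF t], of B] by auto
    have "t = (\<Sum>b\<in>B. der_scale (if deg b = e then Const (const_coeff (s b)) else 0) b)"
      by (rule homogeneous_combination[OF B(3) deg_ge T(3)[OF t] s])
    also have "\<dots> = (\<Sum>b\<in>B'. der_scale (Const (const_coeff (s b))) b)"
      using B(1) by (intro sum.mono_neutral_cong_right) (auto simp: B'_def)
    finally show ?thesis by (rule exI[where x = "\<lambda>b. const_coeff (s b)"])
  qed
  have "T \<subseteq> der.span B'"
  proof
    fix t assume "t \<in> T"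
    then obtain c where t: "t = (\<Sum>b\<in>B'. der_scale (Const (c b)) b)" using T_comb by blast
    show "t \<in> der.span B'" unfolding t by (intro der.span_sum der.span_scale der.span_base)
  qed
  then have M_sub: "M \<subseteq> der.span B'" using sT der.span_minimal[OF _ der.subspace_span] by blast
  have fB': "finite B'" using B(1) by (simp add: B'_def)
  have "B \<subseteq> B'"
  proof (rule ccontr)
    assume "\<not> B \<subseteq> B'"
    then obtain b where b: "b \<in> B" "b \<notin> B'" by blast
    then obtain r where r: "b = (\<Sum>v\<in>B'. der_scale (r v) v)"
      using BM[of b] M_sub der.span_finite[OF fB'] by blast
    define u where "u v = (if v = b then - 1 else r v)" for v
    have "(\<Sum>v\<in>insert b B'. der_scale (u v) v) = der_scale (- 1) b + (\<Sum>v\<in>B'. der_scale (u v) v)"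
      using fB' b by (simp add: u_def)
    also have "(\<Sum>v\<in>B'. der_scale (u v) v) = b"
      using b by (subst r, intro sum.cong) (auto simp: u_def)
    also have "der_scale (- 1) b + b = 0" by (simp add: fun_eq_iff)
    finally have "(\<Sum>v\<in>insert b B'. der_scale (u v) v) = 0" .
    moreover have "u b \<noteq> 0" by (simp add: u_def)
    ultimately have "der.dependent (insert b B')"
      unfolding der.dependent_finite[OF finite.insertI[OF fB']] by blast
    moreover have "insert b B' \<subseteq> B" using b by (auto simp: B'_def)
    ultimately show False using iB der.dependent_mono by blast
  qed
  then have B'B: "B' = B" by (auto simp: B'_def)
  then show deg: "\<And>b. b \<in> B \<Longrightarrow> deg b = e" by (auto simp: B'_def)
  have TB: "T \<subseteq> cst.span B"
  proof
    fix t assume "t \<in> T"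
    then obtain c where t: "t = (\<Sum>b\<in>B. const_scale (c b) b)"
      using T_comb B'B unfolding const_scale_def by blast
    show "t \<in> cst.span B" unfolding t by (intro cst.span_sum cst.span_scale cst.span_base)
  qed
  have BT: "B \<subseteq> cst.span T"
  proof
    fix b assume b: "b \<in> B"
    obtain s where "b = (\<Sum>t\<in>T. der_scale (s t) t)" using expand[OF BM[OF b], of T] by auto
    from homogeneous_combination[OF T(3) _ B(3)[OF b] this] deg[OF b]
    have eq: "b = (\<Sum>t\<in>T. const_scale (const_coeff (s t)) t)" by (simp add: const_scale_def)
    show "b \<in> cst.span T" by (subst eq) (intro cst.span_sum cst.span_scale cst.span_base)
  qed
  show "card B = card T"
    using cst.independent_span_bound[OF T(1) independent_over_constants[OF B(1) iB] BT]
      cst.independent_span_bound[OF B(1) independent_over_constants[OF T(1) iT] TB] by simp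
qed

lemma homogeneous_poly_mult:
  assumes "homogeneous_poly d p" "homogeneous_poly e q"
  shows "homogeneous_poly (d + e) (p * q)"
  unfolding homogeneous_poly_def
proof (intro allI impI)
  fix i j k assume "coeff3 (p * q) i j k \<noteq> 0"
  then obtain i' j' k' where le: "i' \<le> i" "j' \<le> j" "k' \<le> k"
    and nz: "coeff3 p i' j' k' * coeff3 q (i - i') (j - j') (k - k') \<noteq> 0"
    unfolding coeff3_mult by (meson sum.not_neutral_contains_not_neutral atMost_iff)
  then have "i' + j' + k' = d" "(i - i') + (j - j') + (k - k') = e"
    using assms unfolding homogeneous_poly_def by (metis mult_zero_left, metis mult_zero_right)
  then show "i + j + k = d + e" using le by linarith
qed

lemma homogeneous_poly_add:
  "homogeneous_poly d p \<Longrightarrow> homogeneous_poly d q \<Longrightarrow> homogeneous_poly d (p + q)"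
  unfolding homogeneous_poly_def coeff_add by (metis add_0)

lemma homogeneous_poly_uminus: "homogeneous_poly d p \<Longrightarrow> homogeneous_poly d (- p)"
  by (simp add: homogeneous_poly_def)

lemma homogeneous_poly_diff:
  "homogeneous_poly d p \<Longrightarrow> homogeneous_poly d q \<Longrightarrow> homogeneous_poly d (p - q)"
  using homogeneous_poly_add[of d p "- q"] homogeneous_poly_uminus[of d q] by simp

lemma homogeneous_poly_Const: "homogeneous_poly 0 (Const c)"
  by (auto simp: homogeneous_poly_def Const_def coeff_pCons split: nat.splits)

lemma homogeneous_poly_var:
  "homogeneous_poly 1 varX" "homogeneous_poly 1 varY" "homogeneous_poly 1 varZ"
  by (auto simp: homogeneous_poly_def varX_def varY_def varZ_def one_pCons coeff_pCons split: nat.splits)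

lemma homogeneous_poly_Const_mult: "homogeneous_poly d p \<Longrightarrow> homogeneous_poly d (Const c * p)"
  using homogeneous_poly_mult[OF homogeneous_poly_Const] by fastforce

lemma homogeneous_poly_power: "homogeneous_poly 1 p \<Longrightarrow> homogeneous_poly n (p ^ n)"
proof (induction n)
  case 0 show ?case using homogeneous_poly_Const[of 1] by (simp add: Const_hom)
next
  case (Suc n) then show ?case using homogeneous_poly_mult[of 1 p n "p ^ n"] by simp
qed

section \<open>A basis for the multiplicity [n,n,n,1,1,1]\<close>

lemma diff_dvd_power_diff: "x - y dvd x ^ n - y ^ n" for x y :: "'a::comm_ring_1"
  by (cases n) (simp_all add: diff_power_eq_sum del: power_Suc)

context
  fixes \<alpha> :: "'k::field" and n :: nat
  assumes \<alpha>: "\<alpha> \<noteq> 0" "\<alpha> \<noteq> 1" and n: "0 < n" and nontriv: "\<alpha> ^ (n - 1) \<noteq> 1"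
begin

text \<open>
  The sign in \<open>powZ\<close> makes \<open>powX + powZ\<close> and \<open>powY + powZ\<close> divisible by \<open>x + z\<close> and \<open>y + z\<close>. For
  \<open>x - \<alpha> y\<close> the corresponding relation involves a constant: modulo this form, \<open>powX\<close> is \<open>\<alpha> * twist * powY\<close>.
\<close>

definition "powX = (varX ^ n :: 'k poly3)"
definition "powY = (varY ^ n :: 'k poly3)"
definition "powZ = (- ((- varZ) ^ n) :: 'k poly3)"
definition "twist = Const (\<alpha> ^ (n - 1))"

definition basisXY :: "'k poly3 \<Rightarrow> 'k poly3"
  where "basisXY = mk_der (formXY \<alpha> * powX) (formXY \<alpha> * powY) (formXY \<alpha> * powZ)"
definition basisXZ :: "'k poly3 \<Rightarrow> 'k poly3"
  where "basisXZ = mk_der (formXZ * powX) (twist * formXZ * powY) (twist * formXZ * powZ)"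
definition basisYZ :: "'k poly3 \<Rightarrow> 'k poly3"
  where "basisYZ = mk_der (formYZ * powX) (twist * formYZ * powY) (formYZ * powZ)"

lemma pow_nz: "powX \<noteq> 0" "powY \<noteq> 0" "powZ \<noteq> 0"
  by (simp_all add: powX_def powY_def powZ_def)

lemma pow_dvd: "formXY \<alpha> dvd powX - Const \<alpha> * twist * powY" "formXZ dvd powX + powZ" "formYZ dvd powY + powZ"
proof -
  have "Const \<alpha> * twist * powY = (Const \<alpha> * varY) ^ n"
    unfolding twist_def powY_def using n by (cases n) (simp_all add: power_mult_distrib Const_hom)
  then show "formXY \<alpha> dvd powX - Const \<alpha> * twist * powY" by (simp add: powX_def diff_dvd_power_diff)
  show "formXZ dvd powX + powZ" "formYZ dvd powY + powZ"
    using diff_dvd_power_diff[of varX "- varZ" n] diff_dvd_power_diff[of varY "- varZ" n]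
    by (simp_all add: powX_def powY_def powZ_def)
qed

lemma var_cancel:
  "formXY \<alpha> dvd powY * p \<Longrightarrow> formXY \<alpha> dvd p" "formXZ dvd powX * p \<Longrightarrow> formXZ dvd p"
  "formYZ dvd powY * p \<Longrightarrow> formYZ dvd p"
proof -
  note [simp] = is_ring_homD[OF is_ring_hom_subst3[OF is_ring_hom_Const]]
  have "coprime_pair varY (formXY \<alpha>)"
    using subst_nonzero(1)[OF \<alpha>] by (intro coprime_pairI[of "Const \<alpha> * varY" varY varZ]) simp_all
  from coprime_pair_power_left[OF this, of n]
  show "formXY \<alpha> dvd powY * p \<Longrightarrow> formXY \<alpha> dvd p" unfolding coprime_pair_def powY_def by blast
  have "coprime_pair varX (formXZ :: 'k poly3)"
    using subst_nonzero(2)[OF \<alpha>] by (intro coprime_pairI[of "- varZ" varY varZ]) simp_all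
  from coprime_pair_power_left[OF this, of n]
  show "formXZ dvd powX * p \<Longrightarrow> formXZ dvd p" unfolding coprime_pair_def powX_def by blast
  have "coprime_pair varY (formYZ :: 'k poly3)"
    using subst_nonzero(3)[OF \<alpha>] by (intro coprime_pairI[of varX "- varZ" varZ]) simp_all
  from coprime_pair_power_left[OF this, of n]
  show "formYZ dvd powY * p \<Longrightarrow> formYZ dvd p" unfolding coprime_pair_def powY_def by blast
qed

lemma powZ_dvd_iff: "powZ dvd p \<longleftrightarrow> varZ ^ n dvd p"
proof -
  have "powZ = varZ ^ n \<or> powZ = - (varZ ^ n)"
    by (cases "even n") (simp_all add: powZ_def power_minus_odd power_minus_even)
  then show ?thesis by (metis minus_dvd_iff)
qed

text \<open>
  After division by the powers of the variables, the congruences compare the three coordinates pairwise.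
  The sum of the differences \<open>v - twist * u\<close>, \<open>u - w\<close> and \<open>w - v\<close> is \<open>(1 - twist) * u\<close>, and \<open>v\<close> and \<open>w\<close> are
  recovered from them as well. So for \<open>twist \<noteq> 1\<close> the quotients of the differences by the respective forms are free coordinates
  on the module; the basis above consists of the derivations for which two of them vanish.
\<close>

lemma multi_der_coordinates:
  "\<theta> \<in> multi_der (X3 \<alpha>) [n, n, n, 1, 1, 1] \<longleftrightarrow> \<theta> \<in> Der \<and> (\<exists>u v w.
    \<theta> varX = u * powX \<and> \<theta> varY = v * powY \<and> \<theta> varZ = w * powZ \<and>
    formXY \<alpha> dvd v - twist * u \<and> formXZ dvd u - w \<and> formYZ dvd w - v)"
proof -
  have eqs: "(u * powX - Const \<alpha> * (v * powY)) = u * (powX - Const \<alpha> * twist * powY) - Const \<alpha> * (powY * (v - twist * u))"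
    "u * powX + w * powZ = powX * (u - w) + w * (powX + powZ)"
    "v * powY + w * powZ = w * (powY + powZ) - powY * (w - v)" for u v w
    by (simp_all add: algebra_simps)
  have dvd: "formXY \<alpha> dvd u * powX - Const \<alpha> * (v * powY) \<longleftrightarrow> formXY \<alpha> dvd v - twist * u"
    "formXZ dvd u * powX + w * powZ \<longleftrightarrow> formXZ dvd u - w"
    "formYZ dvd v * powY + w * powZ \<longleftrightarrow> formYZ dvd w - v" for u v w
  proof -
    have unit: "p dvd Const \<alpha> * q \<Longrightarrow> p dvd q" for p q :: "'k poly3"
      using dvd_mult[of p "Const \<alpha> * q" "Const (1 / \<alpha>)"] formXY_alt(1)[OF \<alpha>]
      by (simp add: mult.assoc[symmetric])
    show "formXY \<alpha> dvd u * powX - Const \<alpha> * (v * powY) \<longleftrightarrow> formXY \<alpha> dvd v - twist * u"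
      unfolding eqs(1) using dvd_diff_right_iff[OF dvd_mult[OF pow_dvd(1)]] unit var_cancel(1) by (metis dvd_mult)
    show "formXZ dvd u * powX + w * powZ \<longleftrightarrow> formXZ dvd u - w"
      unfolding eqs(2) dvd_add_left_iff[OF dvd_mult[OF pow_dvd(2)]] using var_cancel(2) by (metis dvd_mult)
    show "formYZ dvd v * powY + w * powZ \<longleftrightarrow> formYZ dvd w - v"
      unfolding eqs(3) dvd_diff_right_iff[OF dvd_mult[OF pow_dvd(3)]] using var_cancel(3) by (metis dvd_mult)
  qed
  have ex: "varX ^ n dvd p \<longleftrightarrow> (\<exists>u. p = u * powX)" "varY ^ n dvd p \<longleftrightarrow> (\<exists>v. p = v * powY)"
    "varZ ^ n dvd p \<longleftrightarrow> (\<exists>w. p = w * powZ)" for p :: "'k poly3"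
    unfolding powZ_dvd_iff[symmetric] powX_def[symmetric] powY_def[symmetric] by (auto simp: dvd_def mult.commute)
  have "\<theta> \<in> multi_der (X3 \<alpha>) [n, n, n, 1, 1, 1] \<longleftrightarrow> \<theta> \<in> Der \<and>
      varX ^ n dvd \<theta> varX \<and> varY ^ n dvd \<theta> varY \<and> varZ ^ n dvd \<theta> varZ \<and>
      formXY \<alpha> dvd \<theta> varX - Const \<alpha> * \<theta> varY \<and> formXZ dvd \<theta> varX + \<theta> varZ \<and> formYZ dvd \<theta> varY + \<theta> varZ"
    unfolding multi_der_X3_iff X3_cong_def by simp
  also have "\<dots> \<longleftrightarrow> \<theta> \<in> Der \<and> (\<exists>u v w.
    \<theta> varX = u * powX \<and> \<theta> varY = v * powY \<and> \<theta> varZ = w * powZ \<and>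
    formXY \<alpha> dvd v - twist * u \<and> formXZ dvd u - w \<and> formYZ dvd w - v)" (is "?L \<longleftrightarrow> ?R")
  proof
    assume L: ?L
    then obtain u v w where "\<theta> varX = u * powX" "\<theta> varY = v * powY" "\<theta> varZ = w * powZ" unfolding ex by blast
    with L show ?R using dvd(1)[of u v] dvd(2)[of u w] dvd(3)[of v w] by metis
  next
    assume R: ?R
    then obtain u v w where "\<theta> varX = u * powX" "\<theta> varY = v * powY" "\<theta> varZ = w * powZ"
      "formXY \<alpha> dvd v - twist * u" "formXZ dvd u - w" "formYZ dvd w - v" by blast
    then show ?L using R dvd(1)[of u v] dvd(2)[of u w] dvd(3)[of v w] unfolding ex by metis
  qed
  finally show ?thesis .
qed

lemma combination_coordinates:
  fixes A B C :: "'k poly3"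
  defines "\<theta> \<equiv> der_scale A basisXY + der_scale B basisXZ + der_scale C basisYZ"
  shows "\<theta> varX = (A * formXY \<alpha> + B * formXZ + C * formYZ) * powX"
    "\<theta> varY = (A * formXY \<alpha> + twist * (B * formXZ + C * formYZ)) * powY"
    "\<theta> varZ = (A * formXY \<alpha> + twist * (B * formXZ) + C * formYZ) * powZ"
  unfolding \<theta>_def basisXY_def basisXZ_def basisYZ_def by (simp_all add: algebra_simps)

lemma twist_inverse: "Const (1 / (1 - \<alpha> ^ (n - 1))) * (1 - twist) = 1"
  using nontriv by (simp add: twist_def Const_hom[symmetric])

lemma basis_combination_0:
  assumes "der_scale A basisXY + der_scale B basisXZ + der_scale C basisYZ = 0"
  shows "A = 0 \<and> B = 0 \<and> C = 0"
proof -
  note c = combination_coordinates[of A B C, unfolded assms]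
  have u: "A * formXY \<alpha> + B * formXZ + C * formYZ = 0" using c(1) pow_nz by simp
  have v: "A * formXY \<alpha> + twist * (B * formXZ + C * formYZ) = 0" using c(2) pow_nz by simp
  have w: "A * formXY \<alpha> + twist * (B * formXZ) + C * formYZ = 0" using c(3) pow_nz by simp
  have "(1 - twist) * (A * formXY \<alpha>) = 0" "(1 - twist) * (B * formXZ) = 0" "(1 - twist) * (C * formYZ) = 0"
    using u v w by algebra+
  moreover have "1 - twist \<noteq> 0" using twist_inverse by auto
  ultimately show ?thesis using subst_nonzero(1-3)[OF \<alpha>] by auto
qed

lemma basis_distinct: "basisXY \<noteq> basisXZ" "basisXY \<noteq> basisYZ" "basisXZ \<noteq> basisYZ"
  using basis_combination_0[of 1 "- 1" 0] basis_combination_0[of 1 0 "- 1"] basis_combination_0[of 0 1 "- 1"]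
  by (auto simp: fun_eq_iff)

lemma is_basis_X3: "is_basis {basisXY, basisXZ, basisYZ} (multi_der (X3 \<alpha>) [n, n, n, 1, 1, 1])"
  unfolding is_basis_def
proof
  show "\<not> der.dependent {basisXY, basisXZ, basisYZ}"
    unfolding der.dependent_finite[OF finite.insertI[OF finite.insertI[OF finite.insertI[OF finite.emptyI]]]]
    using basis_distinct basis_combination_0 by (auto simp: add.assoc[symmetric])
  show "der.span {basisXY, basisXZ, basisYZ} = multi_der (X3 \<alpha>) [n, n, n, 1, 1, 1]"
  proof (rule antisym)
    have D: "basisXY \<in> Der" "basisXZ \<in> Der" "basisYZ \<in> Der"
      by (simp_all add: basisXY_def basisXZ_def basisYZ_def mk_der_Der)
    have "formXY \<alpha> dvd formXY \<alpha> - twist * formXY \<alpha>" by simp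
    then have "basisXY \<in> multi_der (X3 \<alpha>) [n, n, n, 1, 1, 1]"
      unfolding multi_der_coordinates using D
      by (intro conjI exI[of _ "formXY \<alpha>"]) (simp_all add: basisXY_def)
    moreover have "basisXZ \<in> multi_der (X3 \<alpha>) [n, n, n, 1, 1, 1]"
      unfolding multi_der_coordinates using D
      by (intro conjI exI[of _ formXZ] exI[of _ "twist * formXZ"]) (simp_all add: basisXZ_def)
    moreover have "basisYZ \<in> multi_der (X3 \<alpha>) [n, n, n, 1, 1, 1]"
      unfolding multi_der_coordinates using D
      by (intro conjI exI[of _ formYZ] exI[of _ "twist * formYZ"] exI[of _ formYZ]) (simp_all add: basisYZ_def)
    ultimately show "der.span {basisXY, basisXZ, basisYZ} \<subseteq> multi_der (X3 \<alpha>) [n, n, n, 1, 1, 1]"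
      by (intro der.span_minimal subspace_multi_der) simp
    show "multi_der (X3 \<alpha>) [n, n, n, 1, 1, 1] \<subseteq> der.span {basisXY, basisXZ, basisYZ}"
    proof
      fix \<theta> assume "\<theta> \<in> multi_der (X3 \<alpha>) [n, n, n, 1, 1, 1]"
      then obtain u v w where \<theta>: "\<theta> \<in> Der" "\<theta> varX = u * powX" "\<theta> varY = v * powY" "\<theta> varZ = w * powZ"
        and d: "formXY \<alpha> dvd v - twist * u" "formXZ dvd u - w" "formYZ dvd w - v"
        unfolding multi_der_coordinates by blast
      obtain A\<^sub>0 B\<^sub>0 C\<^sub>0 where ABC: "v - twist * u = formXY \<alpha> * A\<^sub>0" "u - w = formXZ * B\<^sub>0" "w - v = formYZ * C\<^sub>0"
        using d unfolding dvd_def by blast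
      define \<kappa> where "\<kappa> = Const (1 / (1 - \<alpha> ^ (n - 1)))"
      have \<kappa>: "\<kappa> * (1 - twist) = 1" using twist_inverse by (simp add: \<kappa>_def)
      define \<eta> where "\<eta> = der_scale (\<kappa> * A\<^sub>0) basisXY + der_scale (\<kappa> * B\<^sub>0) basisXZ + der_scale (\<kappa> * C\<^sub>0) basisYZ"
      have \<eta>: "\<eta> \<in> der.span {basisXY, basisXZ, basisYZ}"
        unfolding \<eta>_def by (intro der.span_add der.span_scale der.span_base) simp_all
      have "\<kappa> * A\<^sub>0 * formXY \<alpha> + \<kappa> * B\<^sub>0 * formXZ + \<kappa> * C\<^sub>0 * formYZ = u"
        "\<kappa> * A\<^sub>0 * formXY \<alpha> + twist * (\<kappa> * B\<^sub>0 * formXZ + \<kappa> * C\<^sub>0 * formYZ) = v"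
        "\<kappa> * A\<^sub>0 * formXY \<alpha> + twist * (\<kappa> * B\<^sub>0 * formXZ) + \<kappa> * C\<^sub>0 * formYZ = w"
        using ABC \<kappa> by algebra+
      then have "\<theta> = \<eta>"
        using D \<theta> by (intro Der_eqI) (auto simp: \<eta>_def combination_coordinates simp del: plus_fun_apply der_scale_apply
            intro!: der.subspace_add[OF subspace_Der] der.subspace_scale[OF subspace_Der])
      then show "\<theta> \<in> der.span {basisXY, basisXZ, basisYZ}" using \<eta> by simp
    qed
  qed
qed

lemma basis_homogeneous: "b \<in> {basisXY, basisXZ, basisYZ} \<Longrightarrow> homogeneous_der (n + 1) b"
proof -
  have b: "homogeneous_poly n powX" "homogeneous_poly n powY" "homogeneous_poly n powZ"
    unfolding powX_def powY_def powZ_def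
    by (intro homogeneous_poly_power homogeneous_poly_uminus homogeneous_poly_var)+
  have l: "homogeneous_poly 1 (formXY \<alpha>)" "homogeneous_poly 1 (formXZ :: 'k poly3)" "homogeneous_poly 1 (formYZ :: 'k poly3)"
    by (intro homogeneous_poly_add homogeneous_poly_diff homogeneous_poly_Const_mult homogeneous_poly_var)+
  have m: "homogeneous_poly (n + 1) (p * q)" "homogeneous_poly (n + 1) (twist * p * q)"
    if "homogeneous_poly 1 p" "homogeneous_poly n q" for p q
  proof -
    show "homogeneous_poly (n + 1) (p * q)" using homogeneous_poly_mult[OF that] by (simp add: add.commute)
    then show "homogeneous_poly (n + 1) (twist * p * q)"
      unfolding twist_def mult.assoc by (rule homogeneous_poly_Const_mult)
  qed
  show "b \<in> {basisXY, basisXZ, basisYZ} \<Longrightarrow> homogeneous_der (n + 1) b"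
    unfolding basisXY_def basisXZ_def basisYZ_def homogeneous_der_iff
    by (elim insertE emptyE; simp only: mk_der_Der mk_der_var simp_thms; intro conjI m l b)
qed

lemma free_X3: "free_multiplicity (X3 \<alpha>) [n, n, n, 1, 1, 1]"
  using is_basis_X3 unfolding free_multiplicity_def by blast

lemma exponents_X3: "exponents (X3 \<alpha>) [n, n, n, 1, 1, 1] E \<longleftrightarrow> E = {#n + 1, n + 1, n + 1#}"
proof -
  have card: "card {basisXY, basisXZ, basisYZ} = 3" using basis_distinct by simp
  have const: "image_mset deg (mset_set B) = {#n + 1, n + 1, n + 1#}"
    if "finite B" "card B = 3" "\<And>b. b \<in> B \<Longrightarrow> deg b = n + 1"
    for B :: "('k poly3 \<Rightarrow> 'k poly3) set" and deg :: "_ \<Rightarrow> nat"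
  proof -
    have "image_mset deg (mset_set B) = image_mset (\<lambda>_. n + 1) (mset_set B)"
      using that by (intro image_mset_cong) simp
    also have "\<dots> = replicate_mset 3 (n + 1)" using that by (simp add: image_mset_const_eq)
    finally show ?thesis by (simp add: numeral_3_eq_3)
  qed
  show ?thesis
  proof
    assume "exponents (X3 \<alpha>) [n, n, n, 1, 1, 1] E"
    then obtain B deg where B: "finite B" "is_basis B (multi_der (X3 \<alpha>) [n, n, n, 1, 1, 1])"
      "\<And>\<theta>. \<theta> \<in> B \<Longrightarrow> homogeneous_der (deg \<theta>) \<theta>" and E: "E = image_mset deg (mset_set B)"
      unfolding exponents_def by blast
    note u = homogeneous_basis_unique[OF _ is_basis_X3 basis_homogeneous B]
    show "E = {#n + 1, n + 1, n + 1#}" unfolding E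
    proof (rule const[OF B(1)])
      show "card B = 3" using u(1) card by simp
      show "deg b = n + 1" if "b \<in> B" for b by (rule u(2)[OF _ _ _ that]) simp_all
    qed
  next
    assume "E = {#n + 1, n + 1, n + 1#}"
    then have "E = image_mset (\<lambda>_. n + 1) (mset_set {basisXY, basisXZ, basisYZ})"
      using const[of "{basisXY, basisXZ, basisYZ}" "\<lambda>_. n + 1"] card by simp
    then show "exponents (X3 \<alpha>) [n, n, n, 1, 1, 1] E"
      unfolding exponents_def using is_basis_X3 basis_homogeneous
      by (intro exI[of _ "{basisXY, basisXZ, basisYZ}"] exI[of _ "\<lambda>_. n + 1"]) blast
  qed
qed

end

section \<open>The classification\<close>

lemma free_X3_iff:
  fixes \<alpha> :: "'k::field_char_0"
  assumes \<alpha>: "\<alpha> \<noteq> 0" "\<alpha> \<noteq> 1" and n: "0 < n"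
  shows "free_multiplicity (X3 \<alpha>) [n, n, n, 1, 1, 1] \<longleftrightarrow> \<alpha> ^ (n - 1) \<noteq> 1"
proof
  assume "free_multiplicity (X3 \<alpha>) [n, n, n, 1, 1, 1]"
  moreover have "\<forall>i<6. 0 < [n, n, n, 1, 1, 1] ! i" unfolding all_less_6 using n by simp
  ultimately show "\<alpha> ^ (n - 1) \<noteq> 1" using free_X3_imp[OF \<alpha>, of "[n, n, n, 1, 1, 1]"] by auto
qed (rule free_X3[OF \<alpha> n])

lemma power_eq_1_iff_root_order:
  fixes a :: "'k::field"
  assumes "root_of_unity a" "0 < n"
  shows "a ^ (n - 1) = 1 \<longleftrightarrow> [n = 1] (mod root_order a)"
proof -
  let ?r = "root_order a"
  have r: "0 < ?r" "a ^ ?r = 1"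
    using assms(1) LeastI_ex[of "\<lambda>k. 0 < k \<and> a ^ k = 1"] unfolding root_of_unity_def root_order_def by auto
  have least: "a ^ k \<noteq> 1" if "0 < k" "k < ?r" for k
    using not_less_Least[of k "\<lambda>k. 0 < k \<and> a ^ k = 1"] that unfolding root_order_def by blast
  have "a ^ (n - 1) = a ^ (?r * ((n - 1) div ?r) + (n - 1) mod ?r)" by simp
  also have "\<dots> = a ^ ((n - 1) mod ?r)" unfolding power_add power_mult r(2) by simp
  finally have "a ^ (n - 1) = 1 \<longleftrightarrow> (n - 1) mod ?r = 0"
    using least[of "(n - 1) mod ?r"] r(1) by auto
  then show ?thesis using assms(2) by (simp add: cong_altdef_nat dvd_eq_mod_eq_0)
qed

theorem theorem4p2:
  fixes \<alpha> :: "'k::field_char_0"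
  assumes "\<alpha> \<noteq> 0" and "\<alpha> \<noteq> 1"
  shows
    "(\<forall>m. length m = 6 \<and> (\<forall>i<6. 0 < m ! i) \<and> free_multiplicity (X3 \<alpha>) m \<longrightarrow>
        (\<exists>n>0. m = [n, n, n, 1, 1, 1])) \<and>
     (\<not> root_of_unity \<alpha> \<longrightarrow> (\<forall>n>1. free_multiplicity (X3 \<alpha>) [n, n, n, 1, 1, 1])) \<and>
     (root_of_unity \<alpha> \<longrightarrow>
        (\<forall>n>0. free_multiplicity (X3 \<alpha>) [n, n, n, 1, 1, 1] \<longleftrightarrow> \<not> [n = 1] (mod root_order \<alpha>))) \<and>
     (\<alpha> = -1 \<longrightarrow> (\<forall>n>0. free_multiplicity (X3 \<alpha>) [n, n, n, 1, 1, 1] \<longleftrightarrow> even n)) \<and>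
     (\<forall>n>0. free_multiplicity (X3 \<alpha>) [n, n, n, 1, 1, 1] \<longrightarrow>
        (\<forall>E. exponents (X3 \<alpha>) [n, n, n, 1, 1, 1] E \<longleftrightarrow> E = {#n + 1, n + 1, n + 1#}))"
proof (intro conjI impI allI)
  fix m assume "length m = 6 \<and> (\<forall>i<6. 0 < m ! i) \<and> free_multiplicity (X3 \<alpha>) m"
  then show "\<exists>n>0. m = [n, n, n, 1, 1, 1]" using free_X3_imp[OF assms, of m] by blast
next
  fix n :: nat assume "\<not> root_of_unity \<alpha>" "1 < n"
  then have "\<alpha> ^ (n - 1) \<noteq> 1" unfolding root_of_unity_def by (meson zero_less_diff)
  then show "free_multiplicity (X3 \<alpha>) [n, n, n, 1, 1, 1]" using free_X3_iff[OF assms, of n] \<open>1 < n\<close> by simp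
next
  fix n :: nat assume "root_of_unity \<alpha>" "0 < n"
  then show "free_multiplicity (X3 \<alpha>) [n, n, n, 1, 1, 1] \<longleftrightarrow> \<not> [n = 1] (mod root_order \<alpha>)"
    using free_X3_iff[OF assms, of n] power_eq_1_iff_root_order[of \<alpha> n] by blast
next
  fix n :: nat assume \<alpha>: "\<alpha> = - 1" and n: "0 < n"
  have "\<alpha> ^ (n - 1) \<noteq> 1 \<longleftrightarrow> even n"
    using n assms(2) unfolding \<alpha> by (cases n) (auto simp: minus_one_power_iff)
  then show "free_multiplicity (X3 \<alpha>) [n, n, n, 1, 1, 1] \<longleftrightarrow> even n" using free_X3_iff[OF assms n] by blast
next
  fix n :: nat and E assume n: "0 < n" and "free_multiplicity (X3 \<alpha>) [n, n, n, 1, 1, 1]"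
  then have "\<alpha> ^ (n - 1) \<noteq> 1" using free_X3_iff[OF assms n] by blast
  then show "exponents (X3 \<alpha>) [n, n, n, 1, 1, 1] E \<longleftrightarrow> E = {#n + 1, n + 1, n + 1#}"
    by (rule exponents_X3[OF assms n])
qed

end
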